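(* Let $\nu$ be a Borel probability measure on $\mathbb{R}^d$ whose support lies in the interior of $[0,1]^d$, and assume that there are $a>0$ and $C\ge1$ with $\nu(Q)\le C2^{-ak}$ for all $Q\in\mathcal D_k$, $k\ge0$. Then the dyadic local dimensions $\underline s,\overline s$ satisfy $$\int\underline s\,d\nu\le\underline h(\nu)\le\overline h(\nu)\le\int\overline s\,d\nu$$ and $$\Bigl(\int\frac1{\underline s}\,d\nu\Bigr)^{-1}\le\underline D_0(\nu)\le\overline D_0(\nu)\le\Bigl(\int\frac1{\overline s}\,d\nu\Bigr)^{-1}.$$ All reciprocals and integrals in these formulas are finite and positive. Moreover $$\int\underline s\,d\nu\le\liminf_{t\downarrow0}\mathsf h_\nu(t)\le\limsup_{t\downarrow0}\mathsf h_\nu(t)\le\int\overline s\,d\nu.$$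
   Context: $\log$ is the logarithm to base 2 and $\ln$ the natural logarithm; $\mathbb{R}^d$ carries the maximum norm. $\mathcal D_k$ is the partition of the root cube $[0,1]^d$ into $2^{dk}$ dyadic cubes of side length $2^{-k}$ (half-open cubes, with the outer boundary faces of $[0,1]^d$ assigned to the adjacent end cubes, so that the partitions are disjoint and nested, $\mathcal D_0=\{[0,1]^d\}$). $Q_k(x)$ is the cube of $\mathcal D_k$ containing $x$; the null set of $x$ with some $\nu(Q_k(x))=0$ is discarded. $X_k(x)=-\frac1k\log\nu(Q_k(x))$, $\underline s(x)=\liminf_kX_k(x)$, $\overline s(x)=\limsup_kX_k(x)$. Entropy: $h_k(\nu)=-\frac1k\sum_{Q\in\mathcal D_k}\nu(Q)\log\nu(Q)$, $\underline h(\nu)=\liminf_kh_k(\nu)$, $\overline h(\nu)=\limsup_kh_k(\nu)$. Threshold means: for $0<t<1$, $\tau_t(x)=\min\{k\ge1:\nu(Q_k(x))<t\}$, $\varsigma_t(x)=\log(1/t)/\tau_t(x)$, $\mathsf h_\nu(t)=\int\varsigma_t\,d\nu$. Quantization: $\mathfrak e_{N,0}(\nu)=\inf_{1\le\#A\le N}\exp\bigl(\int\ln d(x,A)\,d\nu(x)\bigr)$, infimum over non-empty finite $A\subset\mathbb{R}^d$, $d(x,A)=\inf_{y\in A}\|x-y\|_\infty$; $\underline D_0(\nu)$ and $\overline D_0(\nu)$ are the lower and upper limits of $\frac{\log N}{-\log\mathfrak e_{N,0}(\nu)}$ as $N\to\infty$. *)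

theory Defs
  imports "HOL-Probability.Probability"
begin

text \<open>
  The ambient space \<open>real ^ 'n\<close> has dimension \<open>d = CARD('n)\<close>; the maximum norm is \<^const>\<open>infnorm\<close>,
  and the root cube is \<^term>\<open>cbox 0 1 :: (real ^ 'n) set\<close>.
\<close>

definition msupport :: "'a::topological_space measure \<Rightarrow> 'a set" where
  "msupport \<nu> = {x. \<forall>U. open U \<and> x \<in> U \<longrightarrow> emeasure \<nu> U > 0}"


subsection \<open>Dyadic cubes\<close>

text \<open>
  Cubes are closed on the left and open on the right, except that the end cubes in direction
  \<open>i\<close> (those with \<open>m i + 1 = 2 ^ k\<close>) also contain their points with \<open>x $ i = 1\<close>.
\<close>

definition dyadic_cube :: "nat \<Rightarrow> ('n \<Rightarrow> nat) \<Rightarrow> (real ^ 'n::finite) set" where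
  "dyadic_cube k m =
     {x. \<forall>i. real (m i) / 2 ^ k \<le> x $ i \<and>
             (x $ i < real (m i + 1) / 2 ^ k \<or> m i + 1 = 2 ^ k \<and> x $ i = 1)}"

definition dyadic_partition :: "nat \<Rightarrow> (real ^ 'n::finite) set set" where
  "dyadic_partition k = dyadic_cube k ` {m. \<forall>i. m i < 2 ^ k}"

text \<open>Only meaningful for \<open>x\<close> in the root cube.\<close>

definition dyadic_cell :: "nat \<Rightarrow> real ^ 'n::finite \<Rightarrow> (real ^ 'n) set" where
  "dyadic_cell k x = (THE Q. Q \<in> dyadic_partition k \<and> x \<in> Q)"


subsection \<open>Dyadic local dimensions\<close>

text \<open>
  The values at \<open>k = 0\<close>, and at points \<open>x\<close> in the null set where some \<open>dyadic_cell k x\<close> has measure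
  zero, are irrelevant. The limits are taken in \<^typ>\<open>ereal\<close>, as the upper one may be
  infinite at individual points.
\<close>

definition local_exponent :: "(real ^ 'n::finite) measure \<Rightarrow> nat \<Rightarrow> real ^ 'n \<Rightarrow> real" where
  "local_exponent \<nu> k x = - (1 / real k) * log 2 (measure \<nu> (dyadic_cell k x))"

definition lower_local_dim :: "(real ^ 'n::finite) measure \<Rightarrow> real ^ 'n \<Rightarrow> ereal" where
  "lower_local_dim \<nu> x = liminf (\<lambda>k. ereal (local_exponent \<nu> k x))"

definition upper_local_dim :: "(real ^ 'n::finite) measure \<Rightarrow> real ^ 'n \<Rightarrow> ereal" where
  "upper_local_dim \<nu> x = limsup (\<lambda>k. ereal (local_exponent \<nu> k x))"

text \<open>Integral of an (almost everywhere) nonnegative extended real function.\<close>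

definition pos_integral :: "'a measure \<Rightarrow> ('a \<Rightarrow> ereal) \<Rightarrow> ereal" where
  "pos_integral \<nu> f = enn2ereal (\<integral>\<^sup>+ x. e2ennreal (f x) \<partial>\<nu>)"

definition finite_pos :: "ereal \<Rightarrow> bool" where
  "finite_pos r \<longleftrightarrow> 0 < r \<and> r < \<infinity>"


subsection \<open>Entropy\<close>

text \<open>The convention \<open>0 * log 0 = 0\<close> holds automatically.\<close>

definition dyadic_entropy :: "(real ^ 'n::finite) measure \<Rightarrow> nat \<Rightarrow> real" where
  "dyadic_entropy \<nu> k =
     - (1 / real k) * (\<Sum>Q\<in>dyadic_partition k. measure \<nu> Q * log 2 (measure \<nu> Q))"

definition lower_entropy :: "(real ^ 'n::finite) measure \<Rightarrow> ereal" where
  "lower_entropy \<nu> = liminf (\<lambda>k. ereal (dyadic_entropy \<nu> k))"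

definition upper_entropy :: "(real ^ 'n::finite) measure \<Rightarrow> ereal" where
  "upper_entropy \<nu> = limsup (\<lambda>k. ereal (dyadic_entropy \<nu> k))"


subsection \<open>Threshold means\<close>

text \<open>
  These are used for \<open>0 < t < 1\<close>. If the measures of the dyadic cubes tend to zero uniformly, the
  minimum exists for every \<open>x\<close> in the root cube, and \<open>threshold_exponent \<nu> t\<close> takes values in
  \<open>[0, log 2 (1 / t)]\<close> there.
\<close>

definition threshold_time :: "(real ^ 'n::finite) measure \<Rightarrow> real \<Rightarrow> real ^ 'n \<Rightarrow> nat" where
  "threshold_time \<nu> t x = (LEAST k. k \<ge> 1 \<and> measure \<nu> (dyadic_cell k x) < t)"

definition threshold_exponent :: "(real ^ 'n::finite) measure \<Rightarrow> real \<Rightarrow> real ^ 'n \<Rightarrow> real" where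
  "threshold_exponent \<nu> t x = log 2 (1 / t) / real (threshold_time \<nu> t x)"

definition threshold_mean :: "(real ^ 'n::finite) measure \<Rightarrow> real \<Rightarrow> real" where
  "threshold_mean \<nu> t = (\<integral>x. threshold_exponent \<nu> t x \<partial>\<nu>)"


subsection \<open>Quantization\<close>

definition max_dist :: "real ^ 'n::finite \<Rightarrow> (real ^ 'n) set \<Rightarrow> real" where
  "max_dist x A = (INF y\<in>A. infnorm (x - y))"

text \<open>
  The number \<open>exp (\<integral> ln d(x, A) d\<nu>)\<close>. If \<open>\<nu>\<close> has bounded support, then \<open>ln d(x, A)\<close> is bounded
  above almost everywhere, so its integral either is finite or equals \<open>-\<infinity>\<close>; the second case gives
  the value \<open>0\<close>. The positivity condition is needed because \<open>ln 0 = 0\<close> in HOL.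
\<close>

definition log_quant_cost :: "(real ^ 'n::finite) measure \<Rightarrow> (real ^ 'n) set \<Rightarrow> real" where
  "log_quant_cost \<nu> A =
     (if (AE x in \<nu>. 0 < max_dist x A) \<and> integrable \<nu> (\<lambda>x. ln (max_dist x A))
      then exp (\<integral>x. ln (max_dist x A) \<partial>\<nu>) else 0)"

definition quant_error0 :: "(real ^ 'n::finite) measure \<Rightarrow> nat \<Rightarrow> real" where
  "quant_error0 \<nu> N = Inf (log_quant_cost \<nu> ` {A. finite A \<and> 1 \<le> card A \<and> card A \<le> N})"

definition lower_quant_dim0 :: "(real ^ 'n::finite) measure \<Rightarrow> ereal" where
  "lower_quant_dim0 \<nu> = liminf (\<lambda>N. ereal (log 2 (real N) / - log 2 (quant_error0 \<nu> N)))"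

definition upper_quant_dim0 :: "(real ^ 'n::finite) measure \<Rightarrow> ereal" where
  "upper_quant_dim0 \<nu> = limsup (\<lambda>N. ereal (log 2 (real N) / - log 2 (quant_error0 \<nu> N)))"

end

theory Submission
  imports Defs
begin

text \<open>
  Write \<open>M\<^sub>k\<close> for the mass of the dyadic cell of level \<open>k\<close>. The entropy is the mean of the local
  exponents \<open>X\<^sub>k\<close>, which have a common integrable majorant, so the entropy bounds are Fatou's
  lemma and its reverse. Since the masses decrease along nested cells, the threshold exponent
  with threshold time \<open>\<tau>\<close> lies between \<open>(\<tau> - 1) / \<tau> \<cdot> X\<^bsub>\<tau> - 1\<^esub>\<close> and \<open>X\<^bsub>\<tau>\<^esub>\<close>, and
  \<open>\<tau>\<close> tends to infinity as \<open>t\<close> tends to zero; this gives the bounds for the threshold means and, for the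
  reciprocals, for the means of \<open>\<tau> / log (1/t)\<close>.

  The quantization error is compared with mean threshold times. If \<open>A\<close> has at most \<open>N\<close> points, then
  \<open>- log d(x, A)\<close> is at most the number of \<open>k\<close> with \<open>d(x, A) < 2 ^ (- k)\<close>. Such an \<open>x\<close> has \<open>M\<^sub>k \<ge> t\<close>,
  that is \<open>k < \<tau>\<close>, or lies in one of \<open>3 ^ d N\<close> cubes of mass at most \<open>min t (C 2 ^ (- a k))\<close>. For
  \<open>t = N powr - p\<close> with \<open>p > 1\<close> these masses sum up to a constant independent of \<open>N\<close>. Conversely, placing one
  point in every cube of mass at least \<open>t = N powr - q\<close>, \<open>q < 1\<close>, uses at most \<open>N\<close> points for large
  \<open>N\<close> and gives \<open>- log d(x, A) \<ge> \<tau> - 1\<close>. Finally \<open>p\<close> and \<open>q\<close> tend to 1.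
\<close>

subsection \<open>Fatou's lemma for \<open>pos_integral\<close>\<close>

lemma pos_integral_mono_AE:
  assumes "AE x in M. f x \<le> g x"
  shows "pos_integral M f \<le> pos_integral M g"
  unfolding pos_integral_def less_eq_ennreal.rep_eq[symmetric]
  using assms by (intro nn_integral_mono_AE) (auto intro: e2ennreal_mono)

lemma pos_integral_ereal:
  assumes "integrable M f" "AE x in M. 0 \<le> f x"
  shows "pos_integral M (\<lambda>x. ereal (f x)) = ereal (\<integral>x. f x \<partial>M)"
  using nn_integral_eq_integral[OF assms] integral_nonneg_AE[OF assms(2)]
  unfolding pos_integral_def by simp

text \<open>\<open>e2ennreal\<close> and \<open>enn2ereal\<close> are continuous and monotone, so
  they commute with lower limits and Fatou's lemma transfers from \<open>ennreal\<close>. Allowing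
  any \<open>g\<close> below the pointwise lower limit makes it applicable to the local dimensions
  and to their reciprocals alike.\<close>

lemma pos_integral_le_liminf:
  assumes f: "\<And>n. integrable M (f n)" "\<And>n. AE x in M. 0 \<le> f n x"
    and g: "AE x in M. g x \<le> liminf (\<lambda>n. ereal (f n x))"
  shows "pos_integral M g \<le> liminf (\<lambda>n. ereal (\<integral>x. f n x \<partial>M))"
proof -
  have *: "liminf (\<lambda>n. e2ennreal (ereal (f n x))) = e2ennreal (liminf (\<lambda>n. ereal (f n x)))" for x
    by (rule Liminf_compose_continuous_mono[OF continuous_on_e2ennreal])
       (auto simp: mono_def e2ennreal_mono)
  have "pos_integral M g \<le> pos_integral M (\<lambda>x. liminf (\<lambda>n. ereal (f n x)))"
    by (rule pos_integral_mono_AE[OF g])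
  also have "\<dots> = enn2ereal (\<integral>\<^sup>+x. liminf (\<lambda>n. e2ennreal (ereal (f n x))) \<partial>M)"
    unfolding pos_integral_def * ..
  also have "\<dots> \<le> enn2ereal (liminf (\<lambda>n. \<integral>\<^sup>+x. e2ennreal (ereal (f n x)) \<partial>M))"
    unfolding less_eq_ennreal.rep_eq[symmetric] using f(1)
    by (intro nn_integral_liminf) auto
  also have "\<dots> = liminf (\<lambda>n. enn2ereal (\<integral>\<^sup>+x. e2ennreal (ereal (f n x)) \<partial>M))"
    by (rule Liminf_compose_continuous_mono[OF continuous_on_enn2ereal, symmetric])
       (auto simp: mono_def less_eq_ennreal.rep_eq)
  also have "\<dots> = liminf (\<lambda>n. ereal (\<integral>x. f n x \<partial>M))"
    using pos_integral_ereal[OF f] by (simp add: pos_integral_def)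
  finally show ?thesis .
qed

text \<open>Reverse Fatou: the common majorant \<open>W\<close> prevents mass from escaping to
  infinity, and it makes every \<open>f n\<close> integrable, so that the real integrals are the
  true ones.\<close>

lemma limsup_le_pos_integral:
  assumes f: "\<And>n. f n \<in> borel_measurable M" "\<And>n. AE x in M. 0 \<le> f n x"
    and W: "integrable M W" "\<And>n. AE x in M. f n x \<le> W x"
    and g: "AE x in M. limsup (\<lambda>n. ereal (f n x)) \<le> g x"
  shows "limsup (\<lambda>n. ereal (\<integral>x. f n x \<partial>M)) \<le> pos_integral M g"
proof -
  have int: "integrable M (f n)" for n
    using f(2)[of n] W(2)[of n] by (intro Bochner_Integration.integrable_bound[OF W(1) f(1)]) auto
  have *: "limsup (\<lambda>n. e2ennreal (ereal (f n x))) = e2ennreal (limsup (\<lambda>n. ereal (f n x)))" for x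
    by (rule Limsup_compose_continuous_mono[OF continuous_on_e2ennreal])
       (auto simp: mono_def e2ennreal_mono)
  have W0: "AE x in M. 0 \<le> W x"
    using f(2)[of 0] W(2)[of 0] by eventually_elim auto
  have "limsup (\<lambda>n. ereal (\<integral>x. f n x \<partial>M)) =
        limsup (\<lambda>n. enn2ereal (\<integral>\<^sup>+x. e2ennreal (ereal (f n x)) \<partial>M))"
    using pos_integral_ereal[OF int f(2)] by (simp add: pos_integral_def)
  also have "\<dots> = enn2ereal (limsup (\<lambda>n. \<integral>\<^sup>+x. e2ennreal (ereal (f n x)) \<partial>M))"
    by (rule Limsup_compose_continuous_mono[OF continuous_on_enn2ereal])
       (auto simp: mono_def less_eq_ennreal.rep_eq)
  also have "\<dots> \<le> enn2ereal (\<integral>\<^sup>+x. limsup (\<lambda>n. e2ennreal (ereal (f n x))) \<partial>M)"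
    unfolding less_eq_ennreal.rep_eq[symmetric]
  proof (rule nn_integral_limsup)
    show "(\<lambda>x. e2ennreal (ereal (f i x))) \<in> borel_measurable M" for i
      using f(1)[of i] by simp
    show "(\<lambda>x. ennreal (W x)) \<in> borel_measurable M"
      using W(1) by auto
    show "AE x in M. e2ennreal (ereal (f i x)) \<le> ennreal (W x)" for i
      using W(2)[of i] by eventually_elim (auto intro: ennreal_leI)
    show "(\<integral>\<^sup>+ x. ennreal (W x) \<partial>M) < \<infinity>"
      using nn_integral_eq_integral[OF W(1) W0] by simp
  qed
  also have "\<dots> = pos_integral M (\<lambda>x. limsup (\<lambda>n. ereal (f n x)))"
    unfolding pos_integral_def * ..
  also have "\<dots> \<le> pos_integral M g"
    by (rule pos_integral_mono_AE[OF g])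
  finally show ?thesis .
qed

text \<open>The complement of the support is a union of open null sets; by Lindelof's theorem
  countably many of them suffice.\<close>

lemma AE_in_msupport:
  fixes M :: "'a::second_countable_topology measure"
  assumes "sets M = sets borel"
  shows "AE x in M. x \<in> msupport M"
proof -
  obtain \<U> where \<U>: "\<U> \<subseteq> {U. open U \<and> emeasure M U = 0}" "countable \<U>"
      "\<Union>\<U> = \<Union>{U. open U \<and> emeasure M U = 0}"
    using Lindelof[of "{U. open U \<and> emeasure M U = 0}"] by auto
  have "(\<Union>U\<in>\<U>. U) \<in> null_sets M"
    using \<U>(1,2) assms by (intro null_sets_UN') (auto simp: null_sets_def)
  moreover have "{x \<in> space M. x \<notin> msupport M} \<subseteq> (\<Union>U\<in>\<U>. U)"
    using \<U>(3) by (auto simp: msupport_def not_less)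
  ultimately show ?thesis
    by (auto intro: AE_I')
qed

subsection \<open>Geometry of the dyadic cubes\<close>

lemma component_infnorm_less:
  fixes x :: "real ^ 'n::finite"
  shows "infnorm x < r \<Longrightarrow> \<bar>x $ i\<bar> < r"
  using component_le_infnorm_cart[of x i] by linarith

lemma infnorm_le_cart:
  fixes x :: "real ^ 'n::finite"
  assumes "\<And>i. \<bar>x $ i\<bar> \<le> r"
  shows "infnorm x \<le> r"
  unfolding infnorm_cart using assms by (intro cSup_least) auto

lemma dyadic_cube_sets [measurable]: "dyadic_cube k m \<in> sets borel"
  unfolding dyadic_cube_def by measurable

lemma dyadic_partition_sets: "Q \<in> dyadic_partition k \<Longrightarrow> Q \<in> sets borel"
  by (auto simp: dyadic_partition_def)

lemma finite_index: "finite {m :: 'n::finite \<Rightarrow> nat. \<forall>i. m i < b}"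
  and card_index: "card {m :: 'n::finite \<Rightarrow> nat. \<forall>i. m i < b} = b ^ CARD('n)"
proof -
  have *: "{m :: 'n \<Rightarrow> nat. \<forall>i. m i < b} = PiE UNIV (\<lambda>_. {..<b})"
    by (auto simp: PiE_UNIV_domain)
  show "finite {m :: 'n \<Rightarrow> nat. \<forall>i. m i < b}"
    unfolding * by (intro finite_PiE) auto
  show "card {m :: 'n \<Rightarrow> nat. \<forall>i. m i < b} = b ^ CARD('n)"
    unfolding * by (subst card_PiE) auto
qed

lemma finite_dyadic_partition [simp, intro]:
  "finite (dyadic_partition k :: (real ^ 'n::finite) set set)"
  unfolding dyadic_partition_def by (intro finite_imageI finite_index)

lemma card_dyadic_partition_le:
  "card (dyadic_partition k :: (real ^ 'n::finite) set set) \<le> 2 ^ (k * CARD('n))"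
  unfolding dyadic_partition_def
  using card_image_le[OF finite_index, of "dyadic_cube k"]
  by (simp add: card_index power_mult)

text \<open>Each coordinate of the common point bounds either index by the other. For an end cube,
  whose upper estimate is not strict, the range bound \<open>n i < 2 ^ k\<close> takes its
  place.\<close>

lemma dyadic_cube_index_unique:
  fixes x :: "real ^ 'n::finite"
  assumes "x \<in> dyadic_cube k m" "x \<in> dyadic_cube k m'" "\<forall>i. m i < 2 ^ k" "\<forall>i. m' i < 2 ^ k"
  shows "m = m'"
proof
  fix i
  have bounds: "real (n i) \<le> x $ i * 2 ^ k" "x $ i * 2 ^ k < real (n i) + 1 \<or> n i + 1 = 2 ^ k \<and> x $ i = 1"
    if "x \<in> dyadic_cube k n" for n
    using that by (auto simp: dyadic_cube_def field_simps)
  have *: "n i \<le> n' i"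
    if n: "x \<in> dyadic_cube k n" "x \<in> dyadic_cube k n'" "n i < 2 ^ k" for n n'
  proof -
    from bounds(2)[OF n(2)] consider "x $ i * 2 ^ k < real (n' i) + 1" | "n' i + 1 = 2 ^ k" by blast
    then show ?thesis
    proof cases
      case 1
      then show ?thesis using bounds(1)[OF n(1)] by linarith
    next
      case 2
      then show ?thesis using n(3) by linarith
    qed
  qed
  show "m i = m' i"
    using *[of m m'] *[of m' m] assms by (meson le_antisym)
qed

lemma dyadic_cell_eqI:
  assumes "Q \<in> dyadic_partition k" "x \<in> Q"
  shows "dyadic_cell k x = Q"
  unfolding dyadic_cell_def
proof (rule the_equality)
  fix R assume R: "R \<in> dyadic_partition k \<and> x \<in> R"
  then obtain m where m: "R = dyadic_cube k m" "\<forall>i. m i < 2 ^ k"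
    by (auto simp: dyadic_partition_def)
  moreover obtain n where n: "Q = dyadic_cube k n" "\<forall>i. n i < 2 ^ k"
    using assms(1) by (auto simp: dyadic_partition_def)
  ultimately show "R = Q"
    using R assms(2) dyadic_cube_index_unique[of x k m n] by simp
qed (use assms in auto)

lemma dyadic_partition_disjoint: "disjoint (dyadic_partition k)"
  unfolding disjoint_def by (metis dyadic_cell_eqI disjoint_iff)

text \<open>Rounding down ignores the end-face convention. This is harmless for points of the open
  root cube, whose coordinates are all less than 1.\<close>

definition dyadic_index :: "nat \<Rightarrow> real ^ 'n::finite \<Rightarrow> 'n \<Rightarrow> nat" where
  "dyadic_index k x i = nat \<lfloor>2 ^ k * x $ i\<rfloor>"

lemma
  fixes x :: "real ^ 'n::finite"
  assumes x: "x \<in> box 0 1"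
  shows dyadic_index_less: "dyadic_index k x i < 2 ^ k"
    and dyadic_cell_eq_index: "dyadic_cell k x = dyadic_cube k (dyadic_index k x)"
    and dyadic_cell_in_partition: "dyadic_cell k x \<in> dyadic_partition k"
    and mem_dyadic_cell: "x \<in> dyadic_cell k x"
proof -
  have x': "0 < x $ i" "x $ i < 1" for i
    using x by (auto simp: mem_box_cart)
  have less: "dyadic_index k x i < 2 ^ k" for i
  proof -
    have "2 ^ k * x $ i < 2 ^ k" using x'(2)[of i] by simp
    then have "\<lfloor>2 ^ k * x $ i\<rfloor> < 2 ^ k" by (simp add: floor_less_iff)
    then show ?thesis by (simp add: dyadic_index_def nat_less_iff)
  qed
  have mem: "x \<in> dyadic_cube k (dyadic_index k x)"
  proof -
    have "real (dyadic_index k x i) \<le> 2 ^ k * x $ i" "2 ^ k * x $ i < real (dyadic_index k x i + 1)" for i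
    proof -
      have "real (dyadic_index k x i) = of_int \<lfloor>2 ^ k * x $ i\<rfloor>"
        using x'(1)[of i] by (simp add: dyadic_index_def)
      then show "real (dyadic_index k x i) \<le> 2 ^ k * x $ i" "2 ^ k * x $ i < real (dyadic_index k x i + 1)"
        by linarith+
    qed
    then show ?thesis by (auto simp: dyadic_cube_def field_simps)
  qed
  have part: "dyadic_cube k (dyadic_index k x) \<in> dyadic_partition k"
    using less by (auto simp: dyadic_partition_def)
  show "dyadic_index k x i < 2 ^ k" by (rule less)
  show "dyadic_cell k x = dyadic_cube k (dyadic_index k x)"
    by (rule dyadic_cell_eqI[OF part mem])
  with mem part show "dyadic_cell k x \<in> dyadic_partition k" "x \<in> dyadic_cell k x" by auto
qed

text \<open>Doubling a number turns its floor \<open>m\<close> into \<open>2 * m\<close> or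
  \<open>2 * m + 1\<close>, so the finer cell lies in the one whose index is halved and rounded
  down.\<close>

lemma dyadic_cell_Suc_subset:
  fixes x :: "real ^ 'n::finite"
  assumes x: "x \<in> box 0 1"
  shows "dyadic_cell (Suc k) x \<subseteq> dyadic_cell k x"
proof
  fix y assume y: "y \<in> dyadic_cell (Suc k) x"
  show "y \<in> dyadic_cell k x"
    unfolding dyadic_cell_eq_index[OF x] dyadic_cube_def
  proof (intro CollectI allI)
    fix i
    define m m' where "m = dyadic_index k x i" and "m' = dyadic_index (Suc k) x i"
    have "0 \<le> x $ i" using x by (auto simp: mem_box_cart intro: less_imp_le)
    then have "of_nat m = \<lfloor>2 ^ k * x $ i\<rfloor>" "of_nat m' = \<lfloor>2 * (2 ^ k * x $ i)\<rfloor>"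
      by (simp_all add: m_def m'_def dyadic_index_def mult.assoc)
    then have mm: "2 * m \<le> m'" "m' \<le> 2 * m + 1" by linarith+
    have "real m' \<le> 2 * 2 ^ k * y $ i"
         "2 * 2 ^ k * y $ i < real (m' + 1) \<or> m' + 1 = 2 * 2 ^ k \<and> y $ i = 1"
      using y by (auto simp: dyadic_cell_eq_index[OF x] dyadic_cube_def m'_def field_simps)
    \<comment> \<open>A finer cell containing the end face has odd \<open>m'\<close>, hence
      \<open>m' = 2 * m + 1\<close>, and then the coarser one is an end cube too.\<close>
    moreover have "m + 1 = 2 ^ k" if "m' + 1 = 2 * 2 ^ k"
      using that mm by presburger
    ultimately have "real m \<le> 2 ^ k * y $ i" "2 ^ k * y $ i < real (m + 1) \<or> m + 1 = 2 ^ k \<and> y $ i = 1"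
      using mm by linarith+
    then show "real (dyadic_index k x i) / 2 ^ k \<le> y $ i \<and>
          (y $ i < real (dyadic_index k x i + 1) / 2 ^ k \<or> dyadic_index k x i + 1 = 2 ^ k \<and> y $ i = 1)"
      by (auto simp: m_def field_simps)
  qed
qed

lemma dyadic_cell_antimono:
  fixes x :: "real ^ 'n::finite"
  assumes "x \<in> box 0 1" "j \<le> k"
  shows "dyadic_cell k x \<subseteq> dyadic_cell j x"
  using assms(2) dyadic_cell_Suc_subset[OF assms(1)] by (rule lift_Suc_antimono_le[rotated])

lemma infnorm_dyadic_corner_le:
  fixes x :: "real ^ 'n::finite"
  assumes "x \<in> dyadic_cube k m"
  shows "infnorm (x - (\<chi> i. real (m i) / 2 ^ k)) \<le> 1 / 2 ^ k"
proof (rule infnorm_le_cart)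
  fix i
  from assms have *: "real (m i) / 2 ^ k \<le> x $ i"
     "x $ i < real (m i + 1) / 2 ^ k \<or> m i + 1 = 2 ^ k \<and> x $ i = 1"
    by (auto simp: dyadic_cube_def)
  from *(2) have "x $ i \<le> real (m i + 1) / 2 ^ k"
    by (metis divide_self less_eq_real_def of_nat_numeral of_nat_power
        power_not_zero zero_neq_numeral)
  with *(1) show "\<bar>(x - (\<chi> i. real (m i) / 2 ^ k)) $ i\<bar> \<le> 1 / 2 ^ k"
    by (auto simp: abs_le_iff add_divide_distrib)
qed

text \<open>Coordinates closer than one mesh width have floors differing by at most 1, which leaves
  three indices per coordinate. The centre \<open>y\<close> may lie outside the root cube.\<close>

lemma dyadic_cells_meeting_ball:
  fixes y :: "real ^ 'n::finite"
  obtains \<Q> where "finite \<Q>" "\<Q> \<subseteq> dyadic_partition k" "card \<Q> \<le> 3 ^ CARD('n)"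
    "\<And>x. x \<in> box 0 1 \<Longrightarrow> infnorm (x - y) < 1 / 2 ^ k \<Longrightarrow> dyadic_cell k x \<in> \<Q>"
proof
  define I where "I = {m :: 'n \<Rightarrow> nat. \<forall>i. m i < 3}"
  \<comment> \<open>The shift \<open>m i - 1\<close> takes the values -1, 0, 1. Near the boundary
    such indices may leave the admissible range or be cut off at 0 by \<open>nat\<close>; the
    intersection with the partition removes foreign cubes and can only lower the count.\<close>
  define R where "R = (\<lambda>m. dyadic_cube k (\<lambda>i. nat (\<lfloor>2 ^ k * y $ i\<rfloor> + int (m i) - 1)) :: (real ^ 'n) set) ` I"
  let ?Q = "R \<inter> dyadic_partition k"
  show "finite ?Q" "?Q \<subseteq> dyadic_partition k" by auto
  have "card ?Q \<le> card R"
    by (intro card_mono) (auto simp: R_def I_def finite_index)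
  also have "\<dots> \<le> card I"
    unfolding R_def by (intro card_image_le) (auto simp: I_def finite_index)
  also have "\<dots> = 3 ^ CARD('n)" unfolding I_def by (rule card_index)
  finally show "card ?Q \<le> 3 ^ CARD('n)" .
  fix x :: "real ^ 'n" assume x: "x \<in> box 0 1" "infnorm (x - y) < 1 / 2 ^ k"
  define m where "m i = nat (\<lfloor>2 ^ k * x $ i\<rfloor> - \<lfloor>2 ^ k * y $ i\<rfloor> + 1)" for i
  have *: "\<bar>\<lfloor>2 ^ k * x $ i\<rfloor> - \<lfloor>2 ^ k * y $ i\<rfloor>\<bar> \<le> 1" for i
  proof -
    have "\<bar>x $ i - y $ i\<bar> < 1 / 2 ^ k"
      using component_infnorm_less[OF x(2), of i] by simp
    then have "\<bar>2 ^ k * x $ i - 2 ^ k * y $ i\<bar> < 1"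
      by (auto simp: field_simps abs_less_iff)
    then show ?thesis by linarith
  qed
  have "m i < 3" for i
    unfolding m_def using *[of i] by linarith
  then have "m \<in> I"
    unfolding I_def by simp
  moreover have "dyadic_index k x = (\<lambda>i. nat (\<lfloor>2 ^ k * y $ i\<rfloor> + int (m i) - 1))"
  proof
    fix i show "dyadic_index k x i = nat (\<lfloor>2 ^ k * y $ i\<rfloor> + int (m i) - 1)"
      using *[of i] by (auto simp: m_def dyadic_index_def)
  qed
  ultimately have "dyadic_cell k x \<in> R"
    unfolding dyadic_cell_eq_index[OF x(1)] R_def by (intro image_eqI[of _ _ m]) auto
  then show "dyadic_cell k x \<in> ?Q"
    using dyadic_cell_in_partition[OF x(1)] by auto
qed

section \<open>Functions of the dyadic cell and their measurability\<close>

lemma sum_indicator_dyadic_partition: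
  fixes F :: "(real ^ 'n::finite) set \<Rightarrow> real"
  assumes "x \<in> \<Union>(dyadic_partition k)"
  shows "(\<Sum>Q\<in>dyadic_partition k. indicator Q x * F Q) = F (dyadic_cell k x)"
proof -
  from assms obtain R where R: "R \<in> dyadic_partition k" "x \<in> R" by auto
  have "(\<Sum>Q\<in>dyadic_partition k. indicator Q x * F Q) = (\<Sum>Q\<in>dyadic_partition k. if R = Q then F Q else 0)"
    using R by (intro sum.cong) (auto simp: indicator_def dest: dyadic_cell_eqI)
  also have "\<dots> = F R" using R by simp
  also have "R = dyadic_cell k x" using dyadic_cell_eqI[OF R] by simp
  finally show ?thesis .
qed

lemma borel_measurable_dyadic_cell [measurable]:
  fixes F :: "(real ^ 'n::finite) set \<Rightarrow> real"
  shows "(\<lambda>x. F (dyadic_cell k x)) \<in> borel_measurable borel"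
proof -
  \<comment> \<open>Outside all cubes the description defining \<open>dyadic_cell\<close> has no
    solution and denotes the fixed set \<open>THE Q. False\<close>, so the function is constant
    there.\<close>
  have eq: "F (dyadic_cell k x) =
      (\<Sum>Q\<in>dyadic_partition k. indicator Q x * F Q) +
      indicator (- \<Union>(dyadic_partition k)) x * F (THE Q. False)" for x :: "real ^ 'n"
  proof (cases "x \<in> \<Union>(dyadic_partition k)")
    case True
    then show ?thesis using sum_indicator_dyadic_partition[OF True, of F] by (auto simp: indicator_def)
  next
    case False
    then have "dyadic_cell k x = (THE Q. False)"
      unfolding dyadic_cell_def by (intro arg_cong[where f = The]) auto
    moreover have "(\<Sum>Q\<in>dyadic_partition k. indicator Q x * F Q) = 0"
      using False by (intro sum.neutral) auto
    ultimately show ?thesis using False by simp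
  qed
  have "\<Union>(dyadic_partition k :: (real ^ 'n) set set) \<in> sets borel"
    by (intro sets.finite_Union) (auto simp: dyadic_partition_sets)
  then show ?thesis
    unfolding eq
    by (intro borel_measurable_add borel_measurable_sum borel_measurable_times
        borel_measurable_indicator borel_measurable_const borel_comp)
       (auto intro: dyadic_partition_sets)
qed

lemma borel_measurable_local_exponent [measurable]:
  "local_exponent \<nu> k \<in> borel_measurable borel"
  unfolding local_exponent_def by measurable

subsection \<open>Local exponents and entropy\<close>

text \<open>If \<open>u > 0\<close> is the excess of the exponent over \<open>D\<close>, then
  \<open>p\<close> equals \<open>2 powr (- k D)\<close> times \<open>2 powr (- k u)\<close>, and the
  second factor absorbs \<open>u\<close> because \<open>u <= 2 * 2 powr u\<close>.\<close>

lemma mult_excess_le: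
  fixes p D :: real
  assumes "0 \<le> p" "p \<le> 1" "k \<ge> 1"
  shows "p * max 0 (- (1 / real k) * log 2 p - D) \<le> 2 * 2 powr (- real k * D)"
proof (cases "p = 0 \<or> - (1 / real k) * log 2 p - D \<le> 0")
  case True
  then show ?thesis by auto
next
  case False
  define u where "u = - (1 / real k) * log 2 p - D"
  have u: "u > 0" and p: "p > 0" using False assms by (auto simp: u_def)
  have "log 2 p = - real k * D - real k * u"
    using assms(3) by (simp add: u_def field_simps)
  then have "p = 2 powr (- real k * D - real k * u)"
    using p by (metis powr_log_cancel zero_less_numeral numeral_eq_one_iff num.distinct(1))
  also have "\<dots> = 2 powr (- real k * D) / 2 powr (real k * u)"
    by (simp add: powr_diff)
  also have "\<dots> * u \<le> 2 powr (- real k * D) * 2"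
  proof -
    have "u \<le> 2 * (u * ln 2)" using ln2_ge_two_thirds u by simp
    also have "\<dots> \<le> 2 * exp (u * ln 2)" using exp_ge_add_one_self[of "u * ln 2"] by linarith
    also have "\<dots> = 2 * 2 powr u" by (simp add: powr_def)
    also have "\<dots> \<le> 2 * 2 powr (real k * u)" using u assms(3) by (intro mult_left_mono powr_mono) auto
    finally have "u / 2 powr (real k * u) \<le> 2" by (simp add: field_simps)
    from mult_left_mono[OF this, of "2 powr (- real k * D)"] show ?thesis by simp
  qed
  finally show ?thesis using u by (simp add: u_def)
qed

locale decaying_cube_measure = prob_space \<nu>
  for \<nu> :: "(real ^ 'n::finite) measure" +
  fixes a C :: real
  assumes sets_nu [measurable_cong]: "sets \<nu> = sets borel"
    and support: "msupport \<nu> \<subseteq> interior (cbox 0 1)"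
    and a_pos: "a > 0" and C_ge_1: "C \<ge> 1"
    and cube_decay: "Q \<in> dyadic_partition k \<Longrightarrow> measure \<nu> Q \<le> C * 2 powr (- a * real k)"
begin

lemma AE_box: "AE x in \<nu>. x \<in> box 0 1"
  using AE_in_msupport[OF sets_nu] support by (auto elim!: eventually_mono)

lemma partition_sets: "Q \<in> dyadic_partition k \<Longrightarrow> Q \<in> sets \<nu>"
  by (simp add: sets_nu dyadic_partition_sets)

text \<open>Almost every point lies in exactly one cube of level \<open>k\<close>, so a function of
  the cell is almost everywhere a finite simple function. This turns the means of local exponents
  into entropy sums.\<close>

lemma
  fixes F :: "(real ^ 'n) set \<Rightarrow> real"
  shows integrable_dyadic_cell: "integrable \<nu> (\<lambda>x. F (dyadic_cell k x))"
    and integral_dyadic_cell: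
      "(\<integral>x. F (dyadic_cell k x) \<partial>\<nu>) = (\<Sum>Q\<in>dyadic_partition k. measure \<nu> Q * F Q)"
proof -
  let ?S = "\<lambda>x. \<Sum>Q\<in>dyadic_partition k. indicator Q x * F Q"
  have ae: "AE x in \<nu>. ?S x = F (dyadic_cell k x)"
    using AE_box
  proof eventually_elim
    case (elim x)
    then show ?case
      using dyadic_cell_in_partition[OF elim, of k] mem_dyadic_cell[OF elim, of k]
      by (intro sum_indicator_dyadic_partition) auto
  qed
  have [measurable]: "(\<lambda>x. F (dyadic_cell k x)) \<in> borel_measurable \<nu>" by measurable
  have ind: "integrable \<nu> (\<lambda>x. indicator Q x * F Q)" if "Q \<in> dyadic_partition k" for Q
    using partition_sets[OF that] by (intro integrable_mult_left) (simp add: emeasure_eq_measure)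
  then have S: "integrable \<nu> ?S" by (intro Bochner_Integration.integrable_sum) auto
  then show "integrable \<nu> (\<lambda>x. F (dyadic_cell k x))"
    using ae by (subst integrable_cong_AE[symmetric, of ?S]) auto
  have "(\<integral>x. F (dyadic_cell k x) \<partial>\<nu>) = (\<integral>x. ?S x \<partial>\<nu>)"
    using ae S by (intro integral_cong_AE) auto
  also have "\<dots> = (\<Sum>Q\<in>dyadic_partition k. measure \<nu> Q * F Q)"
    using ind partition_sets by (subst Bochner_Integration.integral_sum) (auto intro!: sum.cong)
  finally show "(\<integral>x. F (dyadic_cell k x) \<partial>\<nu>) = (\<Sum>Q\<in>dyadic_partition k. measure \<nu> Q * F Q)" .
qed

lemma integrable_local_exponent: "integrable \<nu> (local_exponent \<nu> k)"
  using integrable_dyadic_cell[of "\<lambda>Q. - (1 / real k) * log 2 (measure \<nu> Q)" k]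
  by (simp add: local_exponent_def[abs_def])

lemma integral_local_exponent: "(\<integral>x. local_exponent \<nu> k x \<partial>\<nu>) = dyadic_entropy \<nu> k"
  using integral_dyadic_cell[of "\<lambda>Q. - (1 / real k) * log 2 (measure \<nu> Q)" k]
  by (simp add: local_exponent_def[abs_def] dyadic_entropy_def sum_distrib_left mult_ac sum_negf)

text \<open>The set of full measure on which all pointwise estimates are made. It excludes the
  boundary of the root cube and the null cells, where the logarithm would take its default value
  0.\<close>

definition regular :: "real ^ 'n \<Rightarrow> bool" where
  "regular x \<longleftrightarrow> x \<in> box 0 1 \<and> (\<forall>k. 0 < measure \<nu> (dyadic_cell k x))"

lemma AE_regular: "AE x in \<nu>. regular x"
proof -
  have "AE x in \<nu>. \<forall>Q\<in>dyadic_partition k. x \<in> Q \<longrightarrow> 0 < measure \<nu> Q" for k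
  proof (rule AE_finite_allI)
    fix Q :: "(real ^ 'n) set" assume Q: "Q \<in> dyadic_partition k"
    show "AE x in \<nu>. x \<in> Q \<longrightarrow> 0 < measure \<nu> Q"
    proof (cases "measure \<nu> Q = 0")
      case True
      then have "Q \<in> null_sets \<nu>" using partition_sets[OF Q] by (simp add: emeasure_eq_measure null_sets_def)
      from AE_not_in[OF this] show ?thesis by eventually_elim auto
    qed (simp add: zero_less_measure_iff)
  qed auto
  then have "AE x in \<nu>. \<forall>k. \<forall>Q\<in>dyadic_partition k. x \<in> Q \<longrightarrow> 0 < measure \<nu> Q"
    by (simp add: AE_all_countable)
  with AE_box show ?thesis
    unfolding regular_def
    by eventually_elim (blast intro: dyadic_cell_in_partition mem_dyadic_cell)
qed

lemma
  assumes "regular x"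
  shows regular_box: "x \<in> box 0 1"
    and cell_mass_pos: "0 < measure \<nu> (dyadic_cell k x)"
    and cell_mass_decay: "measure \<nu> (dyadic_cell k x) \<le> C * 2 powr (- a * real k)"
    and cell_mass_antimono: "j \<le> k \<Longrightarrow> measure \<nu> (dyadic_cell k x) \<le> measure \<nu> (dyadic_cell j x)"
    and local_exponent_nonneg: "0 \<le> local_exponent \<nu> k x"
    and local_exponent_ge: "k \<ge> 1 \<Longrightarrow> a - log 2 C / real k \<le> local_exponent \<nu> k x"
proof -
  show box: "x \<in> box 0 1" and pos: "0 < measure \<nu> (dyadic_cell k x)" for k
    using assms by (auto simp: regular_def)
  show decay: "measure \<nu> (dyadic_cell k x) \<le> C * 2 powr (- a * real k)"
    by (intro cube_decay dyadic_cell_in_partition box)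
  show "measure \<nu> (dyadic_cell k x) \<le> measure \<nu> (dyadic_cell j x)" if "j \<le> k"
    by (intro finite_measure_mono dyadic_cell_antimono box that partition_sets[OF dyadic_cell_in_partition])
  have "log 2 (measure \<nu> (dyadic_cell k x)) \<le> 0"
    using pos[of k] by simp
  then show "0 \<le> local_exponent \<nu> k x"
    by (simp add: local_exponent_def zero_le_divide_iff divide_le_0_iff)
  assume k: "k \<ge> 1"
  have "log 2 (measure \<nu> (dyadic_cell k x)) \<le> log 2 (C * 2 powr (- a * real k))"
    using decay pos[of k] C_ge_1 by simp
  also have "\<dots> = log 2 C - a * real k"
    using C_ge_1 by (simp add: log_mult)
  finally have "a * real k - log 2 C \<le> - log 2 (measure \<nu> (dyadic_cell k x))" by simp
  from divide_right_mono[OF this, of "real k"] show "a - log 2 C / real k \<le> local_exponent \<nu> k x"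
    using k by (simp add: local_exponent_def diff_divide_distrib)
qed

text \<open>The correction \<open>log 2 C / k\<close> vanishes in the limit. The bound keeps the
  reciprocals of the local dimensions below \<open>1 / a\<close>.\<close>

lemma a_le_lower_local_dim:
  assumes "regular x"
  shows "ereal a \<le> lower_local_dim \<nu> x"
proof -
  have "(\<lambda>k. a - log 2 C / real k) \<longlonglongrightarrow> a - 0"
    by (intro tendsto_intros)
  then have "ereal a = liminf (\<lambda>k. ereal (a - log 2 C / real k))"
    by (intro lim_imp_Liminf[symmetric]) auto
  also have "\<dots> \<le> liminf (\<lambda>k. ereal (local_exponent \<nu> k x))"
    by (intro Liminf_mono eventually_sequentiallyI[of 1]) (auto intro: local_exponent_ge assms)
  finally show ?thesis by (simp add: lower_local_dim_def)
qed

lemma lower_le_upper_local_dim: "lower_local_dim \<nu> x \<le> upper_local_dim \<nu> x"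
  unfolding lower_local_dim_def upper_local_dim_def by (intro Liminf_le_Limsup) simp

text \<open>The majorant is \<open>D + (\<Sum>k. max 0 (X\<^sub>k - D))\<close> with \<open>D = d + 1\<close>. Its series has a finite integral
  since, by \<open>mult_excess_le\<close>, each of the at most \<open>2 ^ (d k)\<close> cubes of level \<open>k\<close> contributes at
  most \<open>2 \<cdot> 2 ^ (- k D)\<close>.\<close>

lemma local_exponent_majorant:
  obtains W where "integrable \<nu> W" "AE x in \<nu>. \<forall>k. local_exponent \<nu> k x \<le> W x"
proof
  define D where "D = real (CARD('n) + 1)"
  define g where "g k x = max 0 (local_exponent \<nu> k x - D)" for k x
  define S where "S x = (\<Sum>k. ennreal (g k x))" for x
  define W where "W x = D + enn2real (S x)" for x
  have [measurable]: "g k \<in> borel_measurable \<nu>" for k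
    unfolding g_def by measurable
  have [measurable]: "S \<in> borel_measurable \<nu>"
    unfolding S_def by measurable
  have int_g: "(\<integral>\<^sup>+x. ennreal (g k x) \<partial>\<nu>) \<le> ennreal (2 * (1/2) ^ k)" for k
  proof -
    have int: "integrable \<nu> (g k)"
      using integrable_local_exponent[of k] by (auto simp: g_def[abs_def])
    have "(\<integral>x. g k x \<partial>\<nu>) \<le> 2 * (1/2) ^ k"
    proof (cases "k = 0")
      \<comment> \<open>Division by zero makes the exponent of level 0 equal to 0, so its excess
        vanishes.\<close>
      case True
      then show ?thesis by (simp add: g_def local_exponent_def D_def)
    next
      case False
      have "(\<integral>x. g k x \<partial>\<nu>) = (\<Sum>Q\<in>dyadic_partition k. measure \<nu> Q *
           max 0 (- (1 / real k) * log 2 (measure \<nu> Q) - D))"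
        unfolding g_def local_exponent_def
        by (rule integral_dyadic_cell[of "\<lambda>Q. max 0 (- (1 / real k) * log 2 (measure \<nu> Q) - D)"])
      also have "\<dots> \<le> (\<Sum>Q\<in>(dyadic_partition k :: (real ^ 'n) set set). 2 * 2 powr (- real k * D))"
        using False by (intro sum_mono mult_excess_le) auto
      also have "\<dots> = real (card (dyadic_partition k :: (real ^ 'n) set set)) * (2 * 2 powr (- real k * D))"
        by simp
      also have "\<dots> \<le> 2 ^ (k * CARD('n)) * (2 * 2 powr (- real k * D))"
      proof (rule mult_right_mono)
        have "real (card (dyadic_partition k :: (real ^ 'n) set set)) \<le> real (2 ^ (k * CARD('n)))"
          by (rule of_nat_mono[OF card_dyadic_partition_le])
        then show "real (card (dyadic_partition k :: (real ^ 'n) set set)) \<le> 2 ^ (k * CARD('n))" by simp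
      qed auto
      \<comment> \<open>With \<open>D = d + 1\<close> the exponent is
        \<open>k d - k (d + 1) = - k\<close>.\<close>
      also have "\<dots> = 2 * 2 powr (real (k * CARD('n)) + - real k * D)"
        unfolding powr_add by (simp add: powr_realpow del: of_nat_mult)
      also have "\<dots> = 2 * (1/2) ^ k"
        by (simp add: D_def algebra_simps powr_minus powr_realpow power_one_over inverse_eq_divide)
      finally show ?thesis .
    qed
    then show ?thesis
      using nn_integral_eq_integral[OF int] by (simp add: g_def[abs_def] ennreal_leI)
  qed
  have "(\<integral>\<^sup>+x. S x \<partial>\<nu>) = (\<Sum>k. \<integral>\<^sup>+x. ennreal (g k x) \<partial>\<nu>)"
    unfolding S_def by (intro nn_integral_suminf) auto
  also have "\<dots> \<le> (\<Sum>k. ennreal (2 * (1/2) ^ k))"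
    by (intro suminf_le int_g) auto
  also have "\<dots> = ennreal (\<Sum>k. 2 * (1/2) ^ k)"
    by (intro suminf_ennreal2) (auto intro!: summable_mult)
  also have "\<dots> < \<infinity>" by simp
  finally have S_fin: "(\<integral>\<^sup>+x. S x \<partial>\<nu>) < \<infinity>" .
  then have ae: "AE x in \<nu>. S x \<noteq> \<infinity>"
    by (intro nn_integral_PInf_AE) auto
  have "(\<integral>\<^sup>+x. ennreal (enn2real (S x)) \<partial>\<nu>) = (\<integral>\<^sup>+x. S x \<partial>\<nu>)"
    using ae by (intro nn_integral_cong_AE) (auto simp: less_top)
  then have "integrable \<nu> (\<lambda>x. enn2real (S x))"
    using S_fin by (intro integrableI_bounded) auto
  then show "integrable \<nu> W"
    unfolding W_def by auto
  show "AE x in \<nu>. \<forall>k. local_exponent \<nu> k x \<le> W x"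
    using ae
  proof eventually_elim
    case (elim x)
    show ?case
    proof
      fix k
      \<comment> \<open>A single term is at most the whole series, so one function dominates all
        levels at once.\<close>
      have "ennreal (g k x) \<le> S x"
        unfolding S_def using sum_le_suminf[of "\<lambda>k. ennreal (g k x)" "{k}"] by auto
      then have "g k x \<le> enn2real (S x)"
        using elim by (metis enn2real_ennreal enn2real_mono g_def less_top max.cobounded1 infinity_ennreal_def)
      then show "local_exponent \<nu> k x \<le> W x"
        by (auto simp: W_def g_def)
    qed
  qed
qed

lemma pos_integral_lower_le_lower_entropy:
  "pos_integral \<nu> (lower_local_dim \<nu>) \<le> lower_entropy \<nu>"
  unfolding lower_entropy_def integral_local_exponent[symmetric]
  using AE_regular
  by (intro pos_integral_le_liminf integrable_local_exponent)
     (auto simp: lower_local_dim_def local_exponent_nonneg elim!: eventually_mono)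

lemma upper_entropy_le_pos_integral_upper:
  "upper_entropy \<nu> \<le> pos_integral \<nu> (upper_local_dim \<nu>)"
proof -
  obtain W where W: "integrable \<nu> W" "AE x in \<nu>. \<forall>k. local_exponent \<nu> k x \<le> W x"
    by (rule local_exponent_majorant)
  show ?thesis
    unfolding upper_entropy_def integral_local_exponent[symmetric]
  proof (rule limsup_le_pos_integral[OF _ _ W(1)])
    show "AE x in \<nu>. 0 \<le> local_exponent \<nu> n x" for n
      using AE_regular by eventually_elim (rule local_exponent_nonneg)
    show "AE x in \<nu>. local_exponent \<nu> n x \<le> W x" for n
      using W(2) by eventually_elim auto
  qed (auto simp: upper_local_dim_def)
qed

subsection \<open>Threshold times\<close>

text \<open>The level 0 cell contains the open root cube, which has full measure. So level 0 is
  heavy for every \<open>t < 1\<close>, although \<open>threshold_time\<close> minimises only over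
  \<open>k >= 1\<close>.\<close>

lemma cell_mass_0:
  assumes "regular x"
  shows "measure \<nu> (dyadic_cell 0 x) = 1"
proof -
  have "dyadic_index 0 y = (\<lambda>_. 0)" if "y \<in> box 0 1" for y :: "real ^ 'n"
    using dyadic_index_less[OF that, of 0] by auto
  with regular_box[OF assms] have "y \<in> dyadic_cell 0 x" if "y \<in> box 0 1" for y
    using mem_dyadic_cell[OF that, of 0] that by (simp add: dyadic_cell_eq_index)
  with AE_box have "AE y in \<nu>. y \<in> dyadic_cell 0 x"
    by (auto elim: eventually_mono)
  then show ?thesis
    using partition_sets[OF dyadic_cell_in_partition[OF regular_box[OF assms]]]
    by (simp add: prob_eq_1)
qed

text \<open>Solving \<open>C * 2 powr (- a k) = t\<close> for \<open>k\<close> gives the level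
  \<open>log 2 (C / t) / a\<close>, beyond which every cube is lighter than \<open>t\<close>. This
  bounds all threshold times uniformly.\<close>

lemma decay_less_threshold:
  assumes "0 < t" "log 2 (C / t) / a < real k"
  shows "C * 2 powr (- a * real k) < t"
proof -
  have "log 2 (C / t) < a * real k"
    using assms a_pos by (simp add: field_simps)
  then have "C / t < 2 powr (a * real k)"
    using assms C_ge_1 by (simp add: log_less_iff)
  then show ?thesis
    using assms by (simp add: powr_minus field_simps)
qed

context
  fixes x :: "real ^ 'n" and t :: real
  assumes x: "regular x" and t: "0 < t" "t < 1"
begin

lemma
  shows threshold_time_ge_1: "threshold_time \<nu> t x \<ge> 1"
    and cell_mass_threshold_time: "measure \<nu> (dyadic_cell (threshold_time \<nu> t x) x) < t"
    and threshold_time_le: "real (threshold_time \<nu> t x) \<le> log 2 (C / t) / a + 1"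
proof -
  \<comment> \<open>The first integer strictly beyond the critical level; rounding costs the
    additive 1 in \<open>threshold_time_le\<close>.\<close>
  define k where "k = nat \<lfloor>log 2 (C / t) / a\<rfloor> + 1"
  have "0 \<le> log 2 (C / t) / a"
    using t C_ge_1 a_pos by simp
  then have k: "k \<ge> 1" "log 2 (C / t) / a < real k" "real k \<le> log 2 (C / t) / a + 1"
    unfolding k_def by linarith+
  have *: "k \<ge> 1 \<and> measure \<nu> (dyadic_cell k x) < t"
    using k(1) decay_less_threshold[OF t(1) k(2)] cell_mass_decay[OF x, of k] by linarith
  from LeastI[of "\<lambda>k. k \<ge> 1 \<and> measure \<nu> (dyadic_cell k x) < t", OF *]
  show "threshold_time \<nu> t x \<ge> 1" "measure \<nu> (dyadic_cell (threshold_time \<nu> t x) x) < t"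
    by (auto simp: threshold_time_def)
  have "threshold_time \<nu> t x \<le> k"
    unfolding threshold_time_def using * by (rule Least_le)
  with k(3) show "real (threshold_time \<nu> t x) \<le> log 2 (C / t) / a + 1" by linarith
qed

text \<open>Masses decrease along the nested cells, so the heavy levels form an initial segment of
  the natural numbers, and the threshold time is its length.\<close>

lemma le_cell_mass_iff: "t \<le> measure \<nu> (dyadic_cell k x) \<longleftrightarrow> k < threshold_time \<nu> t x"
proof
  assume "k < threshold_time \<nu> t x"
  then show "t \<le> measure \<nu> (dyadic_cell k x)"
    using not_less_Least[of k "\<lambda>k. k \<ge> 1 \<and> measure \<nu> (dyadic_cell k x) < t"] t cell_mass_0[OF x]
    by (cases "k = 0") (auto simp: threshold_time_def)
next
  assume *: "t \<le> measure \<nu> (dyadic_cell k x)"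
  show "k < threshold_time \<nu> t x"
  proof (rule ccontr)
    assume "\<not> k < threshold_time \<nu> t x"
    then have "measure \<nu> (dyadic_cell k x) \<le> measure \<nu> (dyadic_cell (threshold_time \<nu> t x) x)"
      by (intro cell_mass_antimono x) simp
    with * cell_mass_threshold_time show False by simp
  qed
qed

lemma log_inverse_threshold_pos: "0 < log 2 (1 / t)"
  using t by simp

lemma threshold_exponent_pos: "0 < threshold_exponent \<nu> t x"
  unfolding threshold_exponent_def
  using log_inverse_threshold_pos threshold_time_ge_1 by simp

lemma threshold_exponent_le:
  "threshold_exponent \<nu> t x \<le> local_exponent \<nu> (threshold_time \<nu> t x) x"
proof -
  have "log 2 (measure \<nu> (dyadic_cell (threshold_time \<nu> t x) x)) \<le> log 2 t"
    using cell_mass_threshold_time cell_mass_pos[OF x] t by simp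
  then have "log 2 (1 / t) \<le> - log 2 (measure \<nu> (dyadic_cell (threshold_time \<nu> t x) x))"
    using t by (simp add: log_divide)
  from divide_right_mono[OF this, of "real (threshold_time \<nu> t x)"] show ?thesis
    by (simp add: threshold_exponent_def local_exponent_def)
qed

lemma threshold_exponent_ge:
  defines "k \<equiv> threshold_time \<nu> t x - 1"
  shows "real k / (real k + 1) * local_exponent \<nu> k x \<le> threshold_exponent \<nu> t x"
proof -
  have k: "real (threshold_time \<nu> t x) = real k + 1"
    using threshold_time_ge_1 by (simp add: k_def)
  have "t \<le> measure \<nu> (dyadic_cell k x)"
    unfolding le_cell_mass_iff using threshold_time_ge_1 by (simp add: k_def)
  then have "log 2 t \<le> log 2 (measure \<nu> (dyadic_cell k x))"
    using t cell_mass_pos[OF x] by simp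
  then have "- log 2 (measure \<nu> (dyadic_cell k x)) \<le> log 2 (1 / t)"
    using t by (simp add: log_divide)
  \<comment> \<open>The factor \<open>k / (k + 1)\<close> replaces the denominator \<open>k\<close>
    of the local exponent by the threshold time. For \<open>k = 0\<close> the left side is 0 and
    positivity of \<open>log 2 (1 / t)\<close> is enough.\<close>
  from divide_right_mono[OF this, of "real k + 1"] show ?thesis
    using log_inverse_threshold_pos
    unfolding threshold_exponent_def local_exponent_def k by (cases "k = 0") auto
qed

end

lemma measurable_threshold_time [measurable]:
  "threshold_time \<nu> t \<in> measurable \<nu> (count_space UNIV)"
  unfolding threshold_time_def by measurable

lemma measurable_threshold_exponent [measurable]:
  "threshold_exponent \<nu> t \<in> borel_measurable \<nu>"
  unfolding threshold_exponent_def by measurable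

context
  fixes t :: "nat \<Rightarrow> real"
  assumes t: "\<And>n. 0 < t n" "\<And>n. t n < 1" "t \<longlonglongrightarrow> 0"
begin

text \<open>At a fixed level the cell mass is a positive number, which \<open>t n\<close> eventually
  undercuts; that level is then below the threshold time.\<close>

lemma filterlim_threshold_time:
  assumes "regular x"
  shows "filterlim (\<lambda>n. threshold_time \<nu> (t n) x) at_top sequentially"
  unfolding filterlim_at_top
proof
  fix k
  have "eventually (\<lambda>n. t n < measure \<nu> (dyadic_cell k x)) sequentially"
    using t(3) cell_mass_pos[OF assms] by (rule order_tendstoD)
  then show "eventually (\<lambda>n. k \<le> threshold_time \<nu> (t n) x) sequentially"
  proof eventually_elim
    case (elim n)
    then show ?case
      using le_cell_mass_iff[OF assms t(1,2), of n k] by simp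
  qed
qed

lemma lower_le_liminf_threshold_exponent:
  assumes x: "regular x"
  shows "lower_local_dim \<nu> x \<le> liminf (\<lambda>n. ereal (threshold_exponent \<nu> (t n) x))"
  unfolding le_Liminf_iff
proof (intro allI impI)
  fix y assume y: "y < lower_local_dim \<nu> x"
  \<comment> \<open>Two intermediate values: the local exponents eventually exceed \<open>b\<close>,
    and the gap between \<open>c\<close> and \<open>b\<close> absorbs the factor
    \<open>k / (k + 1)\<close>, which tends to 1.\<close>
  then obtain c where c: "y < ereal c" "ereal c < lower_local_dim \<nu> x" using ereal_dense2 by blast
  then obtain b where b: "c < b" "ereal b < lower_local_dim \<nu> x"
    using ereal_dense2[of "ereal c"] by auto
  have pos: "0 < threshold_exponent \<nu> (t n) x" for n
    by (rule threshold_exponent_pos[OF x t(1,2)])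
  show "eventually (\<lambda>n. y < ereal (threshold_exponent \<nu> (t n) x)) sequentially"
  proof (cases "c < 0")
    case True
    then have "y < ereal (threshold_exponent \<nu> (t n) x)" for n
      using less_trans[OF c(1), of "ereal (threshold_exponent \<nu> (t n) x)"] pos[of n] by simp
    then show ?thesis by simp
  next
    case False
    have lim: "filterlim (\<lambda>n. threshold_time \<nu> (t n) x - 1) at_top sequentially"
      using filterlim_threshold_time[OF x] filterlim_compose[OF filterlim_minus_const_nat_at_top] by blast
    have "eventually (\<lambda>k. b < local_exponent \<nu> k x) sequentially"
      using less_LiminfD[OF b(2)[unfolded lower_local_dim_def]] by simp
    moreover have "eventually (\<lambda>k. c < real k / (real k + 1) * b) sequentially"
    proof (rule order_tendstoD)
      have "(\<lambda>k. real k / real (Suc k) * b) \<longlonglongrightarrow> 1 * b"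
        by (intro tendsto_intros LIMSEQ_n_over_Suc_n)
      then show "(\<lambda>k. real k / (real k + 1) * b) \<longlonglongrightarrow> b"
        by (simp add: add.commute)
    qed (rule b(1))
    ultimately have "eventually (\<lambda>k. c < real k / (real k + 1) * local_exponent \<nu> k x) sequentially"
    proof eventually_elim
      case (elim k)
      note elim(2)
      also have "real k / (real k + 1) * b \<le> real k / (real k + 1) * local_exponent \<nu> k x"
        using elim(1) by (intro mult_left_mono) auto
      finally show ?case .
    qed
    from eventually_compose_filterlim[OF this lim] show ?thesis
    proof eventually_elim
      case (elim n)
      note c(1)
      also have "ereal c < ereal (threshold_exponent \<nu> (t n) x)"
        using elim threshold_exponent_ge[OF x t(1,2), of n] by simp
      finally show ?case .
    qed
  qed
qed

text \<open>The threshold exponents are dominated by local exponents evaluated along levels tending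
  to infinity.\<close>

lemma limsup_threshold_exponent_le_upper:
  assumes x: "regular x"
  shows "limsup (\<lambda>n. ereal (threshold_exponent \<nu> (t n) x)) \<le> upper_local_dim \<nu> x"
  unfolding Limsup_le_iff
proof (intro allI impI)
  fix y assume "y > upper_local_dim \<nu> x"
  then have "eventually (\<lambda>k. ereal (local_exponent \<nu> k x) < y) sequentially"
    unfolding upper_local_dim_def by (rule Limsup_lessD)
  from eventually_compose_filterlim[OF this filterlim_threshold_time[OF x]]
  show "eventually (\<lambda>n. ereal (threshold_exponent \<nu> (t n) x) < y) sequentially"
    by eventually_elim
       (use threshold_exponent_le[OF x t(1,2)] in \<open>meson ereal_less_eq(3) le_less_trans\<close>)
qed

text \<open>The majorant \<open>W\<close> dominates the local exponents of all levels
  simultaneously, hence also at the level \<open>threshold_time\<close>, which varies with the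
  point.\<close>

lemma
  shows pos_integral_lower_le_threshold_mean:
      "pos_integral \<nu> (lower_local_dim \<nu>) \<le> liminf (\<lambda>n. ereal (threshold_mean \<nu> (t n)))"
    and threshold_mean_le_pos_integral_upper:
      "limsup (\<lambda>n. ereal (threshold_mean \<nu> (t n))) \<le> pos_integral \<nu> (upper_local_dim \<nu>)"
proof -
  obtain W where W: "integrable \<nu> W" "AE x in \<nu>. \<forall>k. local_exponent \<nu> k x \<le> W x"
    by (rule local_exponent_majorant)
  have pos: "AE x in \<nu>. 0 \<le> threshold_exponent \<nu> (t n) x" for n
    using AE_regular by eventually_elim (intro less_imp_le threshold_exponent_pos t)
  have le: "AE x in \<nu>. threshold_exponent \<nu> (t n) x \<le> W x" for n
    using AE_regular W(2)
    by eventually_elim (use threshold_exponent_le t in \<open>blast intro: order_trans\<close>)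
  have int: "integrable \<nu> (threshold_exponent \<nu> (t n))" for n
    using pos[of n] le[of n] by (intro Bochner_Integration.integrable_bound[OF W(1)]) auto
  show "pos_integral \<nu> (lower_local_dim \<nu>) \<le> liminf (\<lambda>n. ereal (threshold_mean \<nu> (t n)))"
    unfolding threshold_mean_def
    using AE_regular
    by (intro pos_integral_le_liminf int pos)
       (auto elim!: eventually_mono intro: lower_le_liminf_threshold_exponent)
  show "limsup (\<lambda>n. ereal (threshold_mean \<nu> (t n))) \<le> pos_integral \<nu> (upper_local_dim \<nu>)"
    unfolding threshold_mean_def
    using AE_regular
    by (intro limsup_le_pos_integral[OF _ pos W(1) le])
       (auto elim!: eventually_mono intro: limsup_threshold_exponent_le_upper)
qed

end

text \<open>Fatou's lemma speaks of sequences, so the one-sided limit is tested along sequences in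
  the open unit interval tending to 0.\<close>

lemma pos_integral_lower_le_Liminf_threshold_mean:
  "pos_integral \<nu> (lower_local_dim \<nu>) \<le> Liminf (at_right 0) (\<lambda>t. ereal (threshold_mean \<nu> t))"
  unfolding le_Liminf_iff
proof (intro allI impI)
  fix y assume y: "y < pos_integral \<nu> (lower_local_dim \<nu>)"
  show "eventually (\<lambda>t. y < ereal (threshold_mean \<nu> t)) (at_right 0)"
  proof (rule sequentially_imp_eventually_at_right[of 0 1])
    fix t :: "nat \<Rightarrow> real"
    assume "\<And>n. 0 < t n" "\<And>n. t n < 1" "t \<longlonglongrightarrow> 0"
    from pos_integral_lower_le_threshold_mean[OF this] y
    show "eventually (\<lambda>n. y < ereal (threshold_mean \<nu> (t n))) sequentially"
      by (intro less_LiminfD) auto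
  qed simp
qed

lemma Limsup_threshold_mean_le_pos_integral_upper:
  "Limsup (at_right 0) (\<lambda>t. ereal (threshold_mean \<nu> t)) \<le> pos_integral \<nu> (upper_local_dim \<nu>)"
  unfolding Limsup_le_iff
proof (intro allI impI)
  fix y assume y: "pos_integral \<nu> (upper_local_dim \<nu>) < y"
  show "eventually (\<lambda>t. ereal (threshold_mean \<nu> t) < y) (at_right 0)"
  proof (rule sequentially_imp_eventually_at_right[of 0 1])
    fix t :: "nat \<Rightarrow> real"
    assume "\<And>n. 0 < t n" "\<And>n. t n < 1" "t \<longlonglongrightarrow> 0"
    from threshold_mean_le_pos_integral_upper[OF this] y
    show "eventually (\<lambda>n. ereal (threshold_mean \<nu> (t n)) < y) sequentially"
      by (intro Limsup_lessD) auto
  qed simp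
qed

section \<open>Mean threshold times and the reciprocals of the local dimensions\<close>

definition mean_threshold_time :: "real \<Rightarrow> real" where
  "mean_threshold_time t = (\<integral>x. real (threshold_time \<nu> t x) \<partial>\<nu>)"

lemma integrable_threshold_time:
  assumes "0 < t" "t < 1"
  shows "integrable \<nu> (\<lambda>x. real (threshold_time \<nu> t x))"
  using AE_regular
  by (intro integrable_const_bound[of _ "log 2 (C / t) / a + 1"])
     (auto elim!: eventually_mono simp: threshold_time_le[OF _ assms])

text \<open>The quotient of \<open>threshold_time\<close> and \<open>log 2 (1 / t)\<close> is the
  reciprocal of the threshold exponent, so inversion exchanges upper and lower limits. The bound
  \<open>t n <= s < 1\<close> keeps the denominator away from 0 and yields a constant
  majorant.\<close>

lemma
  fixes t :: "nat \<Rightarrow> real"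
  assumes t: "\<And>n. 0 < t n" "\<And>n. t n \<le> s" "t \<longlonglongrightarrow> 0" and s: "s < 1"
  shows pos_integral_inverse_upper_le:
      "pos_integral \<nu> (\<lambda>x. 1 / upper_local_dim \<nu> x) \<le>
       liminf (\<lambda>n. ereal (mean_threshold_time (t n) / log 2 (1 / t n)))"
    and le_pos_integral_inverse_lower:
      "limsup (\<lambda>n. ereal (mean_threshold_time (t n) / log 2 (1 / t n))) \<le>
       pos_integral \<nu> (\<lambda>x. 1 / lower_local_dim \<nu> x)"
proof -
  have t1: "t n < 1" for n using t(2)[of n] s by linarith
  define f where "f n x = real (threshold_time \<nu> (t n) x) / log 2 (1 / t n)" for n x
  have f_int: "(\<integral>x. f n x \<partial>\<nu>) = mean_threshold_time (t n) / log 2 (1 / t n)" for n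
    by (simp add: f_def mean_threshold_time_def)
  define l0 where "l0 = log 2 (1 / s)"
  have s0: "0 < s" using t(1,2)[of 0] by linarith
  then have l0: "0 < l0" using s by (simp add: l0_def)
  have log1: "l0 \<le> log 2 (1 / t n)" for n
    using t(1,2)[of n] s0 by (simp add: l0_def frac_le)
  have int: "integrable \<nu> (f n)" for n
    unfolding f_def using integrable_threshold_time[OF t(1) t1] by auto
  have nonneg: "0 \<le> f n x" for n x
    unfolding f_def using log1[of n] l0 by (intro divide_nonneg_nonneg) auto
  \<comment> \<open>The threshold time grows at most linearly in \<open>l = log 2 (1 / t n)\<close>;
    after division by \<open>l\<close> the bound decreases in \<open>l\<close>, so \<open>l0\<close>
    gives the worst case.\<close>
  have bound: "AE x in \<nu>. f n x \<le> (log 2 C / l0 + 1) / a + 1 / l0" for n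
    using AE_regular
  proof eventually_elim
    case (elim x)
    define l where "l = log 2 (1 / t n)"
    have l: "l0 \<le> l" "0 < l" using log1[of n] l0 by (simp_all add: l_def)
    have "real (threshold_time \<nu> (t n) x) \<le> log 2 (C / t n) / a + 1"
      using threshold_time_le[OF elim t(1) t1] .
    also have "log 2 (C / t n) = log 2 C + l"
      using t(1)[of n] C_ge_1 by (simp add: l_def log_divide)
    finally have "f n x \<le> ((log 2 C + l) / a + 1) / l"
      using l by (simp add: f_def l_def[symmetric] divide_right_mono)
    also have "\<dots> = (log 2 C / l + 1) / a + 1 / l"
      using l a_pos by (simp add: field_simps)
    also have "\<dots> \<le> (log 2 C / l0 + 1) / a + 1 / l0"
      using l l0 a_pos C_ge_1 by (intro add_mono divide_right_mono divide_left_mono) auto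
    finally show ?case .
  qed
  have inv: "ereal (f n x) = inverse (ereal (threshold_exponent \<nu> (t n) x))" if "regular x" for n x
    using threshold_time_ge_1[OF that t(1) t1, of n] log1[of n] l0
    by (simp add: f_def threshold_exponent_def)
  have ev: "eventually (\<lambda>n. 0 \<le> ereal (threshold_exponent \<nu> (t n) x)) sequentially" if "regular x" for x
    using threshold_exponent_pos[OF that t(1) t1] by (simp add: less_imp_le)
  \<comment> \<open>Inversion on \<open>ereal\<close> reverses order between nonnegative
    values.\<close>
  have low0: "0 \<le> lower_local_dim \<nu> x" if "regular x" for x
    using a_le_lower_local_dim[OF that] a_pos by (meson ereal_less_eq(5) less_imp_le order_trans)
  have "AE x in \<nu>. 1 / upper_local_dim \<nu> x \<le> liminf (\<lambda>n. ereal (f n x))"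
    using AE_regular
  proof eventually_elim
    case (elim x)
    have "0 \<le> limsup (\<lambda>n. ereal (threshold_exponent \<nu> (t n) x))"
      using ev[OF elim] by (intro le_Limsup) auto
    then show ?case
      unfolding inv[OF elim] Liminf_inverse_ereal[OF sequentially_bot ev[OF elim]]
      using limsup_threshold_exponent_le_upper[OF t(1) t1 t(3) elim]
      by (simp add: divide_ereal_def ereal_inverse_antimono)
  qed
  from pos_integral_le_liminf[OF int _ this] nonneg
  show "pos_integral \<nu> (\<lambda>x. 1 / upper_local_dim \<nu> x) \<le>
       liminf (\<lambda>n. ereal (mean_threshold_time (t n) / log 2 (1 / t n)))"
    by (simp add: f_int)
  have "AE x in \<nu>. limsup (\<lambda>n. ereal (f n x)) \<le> 1 / lower_local_dim \<nu> x"
    using AE_regular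
  proof eventually_elim
    case (elim x)
    then show ?case
      unfolding inv[OF elim] Limsup_inverse_ereal[OF sequentially_bot ev[OF elim]]
      using lower_le_liminf_threshold_exponent[OF t(1) t1 t(3) elim] low0[OF elim]
      by (simp add: divide_ereal_def ereal_inverse_antimono)
  qed
  from limsup_le_pos_integral[OF borel_measurable_integrable[OF int] _ _ bound this] nonneg
  show "limsup (\<lambda>n. ereal (mean_threshold_time (t n) / log 2 (1 / t n))) \<le>
       pos_integral \<nu> (\<lambda>x. 1 / lower_local_dim \<nu> x)"
    by (simp add: f_int)
qed

end

subsection \<open>Quantization\<close>

lemma max_dist_less_iff:
  assumes "finite A" "A \<noteq> {}"
  shows "max_dist x A < r \<longleftrightarrow> (\<exists>y\<in>A. infnorm (x - y) < r)"
  unfolding max_dist_def using assms by (subst cInf_less_iff) auto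

lemma max_dist_le:
  assumes "finite A" "y \<in> A"
  shows "max_dist x A \<le> infnorm (x - y)"
  unfolding max_dist_def using assms by (intro cINF_lower) auto

lemma borel_measurable_infnorm_diff [measurable]:
  "(\<lambda>x. infnorm (x - y)) \<in> borel_measurable borel"
  by (intro borel_measurable_continuous_onI continuous_intros)

lemma borel_measurable_max_dist [measurable]:
  assumes "finite A"
  shows "(\<lambda>x. max_dist x A) \<in> borel_measurable borel"
  unfolding max_dist_def using assms by (intro borel_measurable_cINF) (auto simp: countable_finite)

text \<open>Interpolates between the two bounds for the mass of a light cube: the power of
  \<open>t\<close> will compensate the number of points, while the power of the decay bound stays
  summable over the levels.\<close>

lemma min_le_geometric_mean:
  fixes t y \<theta> :: real
  assumes "0 < t" "0 < y" "0 \<le> \<theta>" "\<theta> \<le> 1"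
  shows "min t y \<le> t powr \<theta> * y powr (1 - \<theta>)"
proof -
  have "min t y = min t y powr \<theta> * min t y powr (1 - \<theta>)"
    using assms by (simp flip: powr_add)
  also have "\<dots> \<le> t powr \<theta> * y powr (1 - \<theta>)"
    using assms by (intro mult_mono powr_mono2) auto
  finally show ?thesis .
qed

section \<open>Lower bound for the quantization error\<close>

context decaying_cube_measure
begin

text \<open>The ball meets at most \<open>3 ^ d\<close> cells, and each light one among them obeys
  both the threshold and the uniform decay.\<close>

lemma light_ball_mass_le:
  assumes "0 < t"
  shows "measure \<nu> {x. x \<in> box 0 1 \<and> infnorm (x - y) < 1 / 2 ^ k \<and> measure \<nu> (dyadic_cell k x) < t}
    \<le> 3 ^ CARD('n) * min t (C * 2 powr (- a * real k))"
proof -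
  obtain \<Q> where \<Q>: "finite \<Q>" "\<Q> \<subseteq> dyadic_partition k" "card \<Q> \<le> 3 ^ CARD('n)"
    "\<And>x. x \<in> box 0 1 \<Longrightarrow> infnorm (x - y) < 1 / 2 ^ k \<Longrightarrow> dyadic_cell k x \<in> \<Q>"
    using dyadic_cells_meeting_ball[of k y] by blast
  let ?R = "{Q \<in> \<Q>. measure \<nu> Q < t}"
  have sets: "Q \<in> sets \<nu>" if "Q \<in> \<Q>" for Q using that \<Q>(2) by (auto intro: partition_sets)
  have "measure \<nu> {x. x \<in> box 0 1 \<and> infnorm (x - y) < 1 / 2 ^ k \<and> measure \<nu> (dyadic_cell k x) < t}
      \<le> measure \<nu> (\<Union>Q\<in>?R. Q)"
  proof (rule finite_measure_mono)
    show "{x. x \<in> box 0 1 \<and> infnorm (x - y) < 1 / 2 ^ k \<and> measure \<nu> (dyadic_cell k x) < t} \<subseteq> (\<Union>Q\<in>?R. Q)"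
      using \<Q>(4) mem_dyadic_cell by blast
  qed (use \<Q>(1) sets in auto)
  also have "\<dots> \<le> (\<Sum>Q\<in>?R. measure \<nu> Q)"
    using \<Q>(1) sets by (intro measure_UNION_le) auto
  also have "\<dots> \<le> (\<Sum>Q\<in>?R. min t (C * 2 powr (- a * real k)))"
    using \<Q>(2) cube_decay by (intro sum_mono) auto
  also have "\<dots> = real (card ?R) * min t (C * 2 powr (- a * real k))" by simp
  also have "\<dots> \<le> 3 ^ CARD('n) * min t (C * 2 powr (- a * real k))"
  proof (rule mult_right_mono)
    have "card ?R \<le> card \<Q>" using \<Q>(1) by (intro card_mono) auto
    with \<Q>(3) have "card ?R \<le> 3 ^ CARD('n)" by linarith
    from of_nat_mono[OF this, where ?'a = real] show "real (card ?R) \<le> 3 ^ CARD('n)" by simp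
  qed (use assms C_ge_1 in auto)
  finally show ?thesis .
qed

lemma measure_max_dist_less_le:
  assumes A: "finite A" "A \<noteq> {}" and t: "0 < t" "t < 1"
  shows "measure \<nu> {x. max_dist x A < 1 / 2 ^ k} \<le> measure \<nu> {x. k < threshold_time \<nu> t x}
     + real (card A) * (3 ^ CARD('n) * min t (C * 2 powr (- a * real k)))"
proof -
  define L where
    "L y = {x. x \<in> box 0 1 \<and> infnorm (x - y) < 1 / 2 ^ k \<and> measure \<nu> (dyadic_cell k x) < t}" for y
  have [measurable]: "{x. k < threshold_time \<nu> t x} \<in> sets \<nu>"
    using sets_eq_imp_space_eq[OF sets_nu] measurable_threshold_time[of t] by measurable
  have L [measurable]: "L y \<in> sets \<nu>" for y
    unfolding L_def by measurable
  have UL: "(\<Union>y\<in>A. L y) \<in> sets \<nu>" using A by auto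
  have "measure \<nu> {x. max_dist x A < 1 / 2 ^ k} \<le> measure \<nu> ({x. k < threshold_time \<nu> t x} \<union> (\<Union>y\<in>A. L y))"
  proof (rule finite_measure_mono_AE)
    show "AE x in \<nu>. x \<in> {x. max_dist x A < 1 / 2 ^ k} \<longrightarrow> x \<in> {x. k < threshold_time \<nu> t x} \<union> (\<Union>y\<in>A. L y)"
      using AE_regular
    proof eventually_elim
      case (elim x)
      show ?case
        using le_cell_mass_iff[OF elim t, of k] regular_box[OF elim]
        by (auto simp: max_dist_less_iff[OF A] L_def)
    qed
  qed (use UL in auto)
  also have "\<dots> \<le> measure \<nu> {x. k < threshold_time \<nu> t x} + measure \<nu> (\<Union>y\<in>A. L y)"
    using UL by (intro measure_Un_le) auto
  also have "measure \<nu> (\<Union>y\<in>A. L y) \<le> (\<Sum>y\<in>A. measure \<nu> (L y))"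
    using A by (intro measure_UNION_le) auto
  also have "\<dots> \<le> (\<Sum>y\<in>A. 3 ^ CARD('n) * min t (C * 2 powr (- a * real k)))"
    unfolding L_def by (intro sum_mono light_ball_mass_le t)
  finally show ?thesis by simp
qed

text \<open>Layer cake formula: a natural number is the number of naturals below it.\<close>

lemma suminf_measure_threshold_time:
  assumes "0 < t" "t < 1"
  shows "(\<Sum>k. ennreal (measure \<nu> {x. k < threshold_time \<nu> t x})) = ennreal (mean_threshold_time t)"
proof -
  have [measurable]: "{x. k < threshold_time \<nu> t x} \<in> sets \<nu>" for k
    using sets_eq_imp_space_eq[OF sets_nu] measurable_threshold_time[of t] by measurable
  have "ennreal (mean_threshold_time t) = (\<integral>\<^sup>+x. ennreal (real (threshold_time \<nu> t x)) \<partial>\<nu>)"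
    unfolding mean_threshold_time_def
    by (intro nn_integral_eq_integral[symmetric] integrable_threshold_time assms) auto
  also have "\<dots> = (\<integral>\<^sup>+x. (\<Sum>k. indicator {x. k < threshold_time \<nu> t x} x) \<partial>\<nu>)"
  proof (intro nn_integral_cong)
    fix x
    have "(\<Sum>k. indicator {x. k < threshold_time \<nu> t x} x :: ennreal) =
        (\<Sum>k<threshold_time \<nu> t x. indicator {x. k < threshold_time \<nu> t x} x)"
      by (intro suminf_finite) auto
    also have "\<dots> = ennreal (real (threshold_time \<nu> t x))"
      by (simp add: ennreal_of_nat_eq_real_of_nat)
    finally show "ennreal (real (threshold_time \<nu> t x)) = (\<Sum>k. indicator {x. k < threshold_time \<nu> t x} x)" ..
  qed
  also have "\<dots> = (\<Sum>k. \<integral>\<^sup>+x. indicator {x. k < threshold_time \<nu> t x} x \<partial>\<nu>)"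
    by (intro nn_integral_suminf) auto
  also have "\<dots> = (\<Sum>k. ennreal (measure \<nu> {x. k < threshold_time \<nu> t x}))"
    by (simp add: emeasure_eq_measure)
  finally show ?thesis ..
qed

text \<open>A dyadic count of \<open>- log 2 (max_dist x A)\<close>. Values in
  \<open>ennreal\<close> let it be infinite where the distance is 0, so a finite mean will also
  prove that the distance is positive almost everywhere.\<close>

definition near_count :: "(real ^ 'n) set \<Rightarrow> real ^ 'n \<Rightarrow> ennreal" where
  "near_count A x = (\<Sum>k. indicator {x. max_dist x A < 1 / 2 ^ k} x)"

lemma near_count_finite:
  assumes "A \<noteq> {}" "near_count A x \<noteq> \<infinity>"
  shows "0 < max_dist x A" "- log 2 (max_dist x A) \<le> enn2real (near_count A x)"
proof -
  have part: "of_nat n \<le> near_count A x" if "\<And>k. k < n \<Longrightarrow> max_dist x A < 1 / 2 ^ k" for n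
  proof -
    have "of_nat n = (\<Sum>k<n. indicator {x. max_dist x A < 1 / 2 ^ k} x :: ennreal)"
      using that by simp
    also have "\<dots> \<le> near_count A x"
      unfolding near_count_def by (intro sum_le_suminf) auto
    finally show ?thesis .
  qed
  show pos: "0 < max_dist x A"
  proof (rule ccontr)
    assume "\<not> 0 < max_dist x A"
    then have "max_dist x A < 1 / 2 ^ k" for k
      using zero_less_power[of "2::real" k] by (simp add: not_less order.strict_trans1)
    from part[OF this] have "of_nat n \<le> near_count A x" for n .
    then have "(SUP n. of_nat n) \<le> near_count A x" by (intro SUP_least)
    with assms(2) show False by (simp add: ennreal_SUP_of_nat_eq_top top_unique)
  qed
  \<comment> \<open>All levels below \<open>n\<close> contribute to the count. For distances at
    least 1 this \<open>n\<close> is 0.\<close>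
  define n where "n = nat \<lceil>- log 2 (max_dist x A)\<rceil>"
  have "max_dist x A < 1 / 2 ^ k" if "k < n" for k
  proof -
    have "real k < - log 2 (max_dist x A)"
      using that unfolding n_def by linarith
    then have "log 2 (max_dist x A) < - real k" by simp
    then have "max_dist x A < 2 powr (- real k)"
      using pos by (simp add: log_less_iff)
    then show ?thesis
      by (simp add: powr_minus powr_realpow inverse_eq_divide)
  qed
  from part[OF this] have "of_nat n \<le> near_count A x" .
  then have "real n \<le> enn2real (near_count A x)"
    using assms(2) by (cases "near_count A x") (auto simp: ennreal_of_nat_eq_real_of_nat)
  moreover have "- log 2 (max_dist x A) \<le> real n"
    unfolding n_def by linarith
  ultimately show "- log 2 (max_dist x A) \<le> enn2real (near_count A x)" by linarith
qed

lemma borel_measurable_near_count [measurable]: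
  assumes "finite A"
  shows "near_count A \<in> borel_measurable \<nu>"
proof -
  have [measurable]: "(\<lambda>x. max_dist x A) \<in> borel_measurable \<nu>"
    using borel_measurable_max_dist[OF assms] by measurable
  show ?thesis unfolding near_count_def by measurable
qed

lemma nn_integral_near_count_le:
  assumes p: "p > 1"
  obtains B where "B \<ge> 0"
    "\<And>N A. N \<ge> 2 \<Longrightarrow> finite A \<Longrightarrow> A \<noteq> {} \<Longrightarrow> card A \<le> N \<Longrightarrow>
      (\<integral>\<^sup>+x. near_count A x \<partial>\<nu>) \<le> ennreal (mean_threshold_time (real N powr - p) + B)"
proof
  \<comment> \<open>With this exponent \<open>t powr \<theta>\<close> is \<open>1 / N\<close> for
    \<open>t = N powr - p\<close>, which cancels the factor \<open>N\<close> from the union over the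
    points of \<open>A\<close>.\<close>
  define \<theta> where "\<theta> = 1 / p"
  have \<theta>: "0 < \<theta>" "\<theta> < 1" "\<theta> * p = 1" using p by (auto simp: \<theta>_def)
  define b where "b k = 3 ^ CARD('n) * (C * 2 powr (- a * real k)) powr (1 - \<theta>)" for k
  have b0: "b k \<ge> 0" for k by (simp add: b_def)
  have "b = (\<lambda>k. (3 ^ CARD('n) * C powr (1 - \<theta>)) * (2 powr (- a * (1 - \<theta>))) ^ k)"
    using C_ge_1 by (intro ext) (simp add: b_def powr_mult powr_powr mult_ac flip: powr_realpow)
  \<comment> \<open>Here \<open>p > 1\<close> enters: it gives \<open>\<theta> < 1\<close>, so the
    remaining bounds decay geometrically in \<open>k\<close>.\<close>
  moreover have "\<bar>2 powr (- a * (1 - \<theta>))\<bar> < (1::real)"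
    using a_pos \<theta> powr_less_mono[of "- a * (1 - \<theta>)" 0 "2::real"] by simp
  ultimately have sb: "summable b"
    by (auto intro!: summable_geometric summable_mult)
  show "suminf b \<ge> 0" using sb b0 by (intro suminf_nonneg)
  fix N :: nat and A :: "(real ^ 'n) set"
  assume N: "N \<ge> 2" and A: "finite A" "A \<noteq> {}" "card A \<le> N"
  define t where "t = real N powr - p"
  have t: "0 < t" "t < 1"
    using N p powr_less_mono[of "- p" 0 "real N"] by (simp_all add: t_def)
  have Nt: "real N * t powr \<theta> = 1"
  proof -
    have "t powr \<theta> = real N powr (- (\<theta> * p))"
      by (simp add: t_def powr_powr mult.commute)
    then show ?thesis using N \<theta>(3) by (simp add: powr_minus)
  qed
  have [measurable]: "(\<lambda>x. max_dist x A) \<in> borel_measurable \<nu>"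
    using borel_measurable_max_dist[OF A(1)] by measurable
  have [measurable]: "{x. max_dist x A < 1 / 2 ^ k} \<in> sets \<nu>" for k
    using sets_eq_imp_space_eq[OF sets_nu] by measurable
  have le: "measure \<nu> {x. max_dist x A < 1 / 2 ^ k} \<le> measure \<nu> {x. k < threshold_time \<nu> t x} + b k" for k
  proof -
    have "real (card A) * (3 ^ CARD('n) * min t (C * 2 powr (- a * real k)))
       \<le> real N * (3 ^ CARD('n) * (t powr \<theta> * (C * 2 powr (- a * real k)) powr (1 - \<theta>)))"
      using A t C_ge_1 \<theta> by (intro mult_mono min_le_geometric_mean) auto
    also have "\<dots> = real N * t powr \<theta> * b k"
      by (simp add: b_def mult_ac)
    also have "\<dots> = b k" using Nt by simp
    finally show ?thesis
      using measure_max_dist_less_le[OF A(1,2) t, of k] by linarith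
  qed
  have "(\<integral>\<^sup>+x. near_count A x \<partial>\<nu>) = (\<Sum>k. \<integral>\<^sup>+x. indicator {x. max_dist x A < 1 / 2 ^ k} x \<partial>\<nu>)"
    unfolding near_count_def by (intro nn_integral_suminf) auto
  also have "\<dots> = (\<Sum>k. ennreal (measure \<nu> {x. max_dist x A < 1 / 2 ^ k}))"
    by (simp add: emeasure_eq_measure)
  also have "\<dots> \<le> (\<Sum>k. ennreal (measure \<nu> {x. k < threshold_time \<nu> t x}) + ennreal (b k))"
    using le b0 by (intro suminf_le) (auto simp flip: ennreal_plus intro: ennreal_leI)
  also have "\<dots> = (\<Sum>k. ennreal (measure \<nu> {x. k < threshold_time \<nu> t x})) + (\<Sum>k. ennreal (b k))"
    by (intro suminf_add[symmetric]) auto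
  also have "\<dots> = ennreal (mean_threshold_time t) + ennreal (suminf b)"
    by (simp add: suminf_measure_threshold_time[OF t] suminf_ennreal2[OF b0 sb])
  also have "\<dots> = ennreal (mean_threshold_time t + suminf b)"
    using suminf_nonneg[OF sb b0] by (intro ennreal_plus[symmetric]) (auto simp: mean_threshold_time_def)
  finally show "(\<integral>\<^sup>+x. near_count A x \<partial>\<nu>) \<le> ennreal (mean_threshold_time (real N powr - p) + suminf b)"
    by (simp add: t_def)
qed

text \<open>The mean of \<open>near_count A\<close> is finite, so the distance is positive almost
  everywhere and its logarithm is integrable. Hence \<open>log_quant_cost\<close> does not take its
  default value 0 at non-empty finite sets.\<close>

lemma
  assumes A: "finite A" "A \<noteq> {}"
  shows AE_max_dist_pos: "AE x in \<nu>. 0 < max_dist x A"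
    and integrable_log_max_dist: "integrable \<nu> (\<lambda>x. log 2 (max_dist x A))"
    and log_quant_cost_eq: "log_quant_cost \<nu> A = 2 powr (\<integral>x. log 2 (max_dist x A) \<partial>\<nu>)"
    and integral_log_max_dist_ge: "\<And>b. b \<ge> 0 \<Longrightarrow> (\<integral>\<^sup>+x. near_count A x \<partial>\<nu>) \<le> ennreal b \<Longrightarrow>
      - b \<le> (\<integral>x. log 2 (max_dist x A) \<partial>\<nu>)"
proof -
  have [measurable]: "(\<lambda>x. max_dist x A) \<in> borel_measurable \<nu>"
    using borel_measurable_max_dist[OF A(1)] by measurable
  note borel_measurable_near_count[OF A(1), measurable]
  \<comment> \<open>Only finiteness is wanted, so any exponent above 1 would serve;
    \<open>max 2 (card A)\<close> below is an admissible \<open>N\<close>.\<close>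
  obtain B where "B \<ge> 0" "\<And>N A. N \<ge> 2 \<Longrightarrow> finite A \<Longrightarrow> A \<noteq> {} \<Longrightarrow> card A \<le> N \<Longrightarrow>
      (\<integral>\<^sup>+x. near_count A x \<partial>\<nu>) \<le> ennreal (mean_threshold_time (real N powr - 2) + B)"
    using nn_integral_near_count_le[of 2] by auto
  from this(2)[of "max 2 (card A)" A] A have fin: "(\<integral>\<^sup>+x. near_count A x \<partial>\<nu>) < \<infinity>"
    by (auto intro: le_less_trans)
  then have ae: "AE x in \<nu>. near_count A x \<noteq> \<infinity>"
    by (intro nn_integral_PInf_AE) auto
  then show pos: "AE x in \<nu>. 0 < max_dist x A"
    by eventually_elim (rule near_count_finite(1)[OF A(2)])
  define W where "W x = enn2real (near_count A x)" for x
  have nnW: "(\<integral>\<^sup>+x. ennreal (W x) \<partial>\<nu>) = (\<integral>\<^sup>+x. near_count A x \<partial>\<nu>)"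
    unfolding W_def using ae by (intro nn_integral_cong_AE) (auto simp: less_top)
  have W: "integrable \<nu> W"
    unfolding W_def using fin nnW[unfolded W_def] by (intro integrableI_bounded) auto
  have leW: "AE x in \<nu>. - log 2 (max_dist x A) \<le> W x"
    using ae unfolding W_def by eventually_elim (rule near_count_finite(2)[OF A(2)])
  obtain y where y: "y \<in> A" using A by auto
  \<comment> \<open>Points of the root cube have norm at most 1, so the distance to
    \<open>y\<close>, and thus to \<open>A\<close>, is at most \<open>K\<close>.\<close>
  define K where "K = 1 + infnorm y"
  have K: "K \<ge> 1" by (simp add: K_def infnorm_pos_le)
  have leK: "AE x in \<nu>. log 2 (max_dist x A) \<le> log 2 K"
    using AE_box pos
  proof eventually_elim
    case (elim x)
    have "infnorm x \<le> 1"
    proof (rule infnorm_le_cart)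
      show "\<bar>x $ i\<bar> \<le> 1" for i
        using elim(1) by (simp add: mem_box_cart abs_le_iff) (smt (verit))
    qed
    moreover have "infnorm (x - y) \<le> infnorm x + infnorm y"
      using infnorm_triangle[of x "- y"] by (simp add: infnorm_neg)
    ultimately have "max_dist x A \<le> K"
      using max_dist_le[OF A(1) y, of x] by (simp add: K_def)
    then show ?case using elim(2) K by simp
  qed
  show int: "integrable \<nu> (\<lambda>x. log 2 (max_dist x A))"
  proof (rule Bochner_Integration.integrable_bound)
    \<comment> \<open>The logarithm lies between \<open>- W x\<close> and \<open>log 2 K\<close>; as
      both bounds have nonnegative size, their sum controls its absolute value.\<close>
    show "integrable \<nu> (\<lambda>x. W x + log 2 K)" using W by auto
    show "AE x in \<nu>. norm (log 2 (max_dist x A)) \<le> norm (W x + log 2 K)"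
      using leW leK
    proof eventually_elim
      case (elim x)
      moreover have "0 \<le> W x" "0 \<le> log 2 K" using K by (auto simp: W_def)
      ultimately show ?case by auto
    qed
  qed measurable
  have ln_eq: "ln (max_dist x A) = ln 2 * log 2 (max_dist x A)" for x
    by (simp add: log_def)
  have "integrable \<nu> (\<lambda>x. ln (max_dist x A))"
    unfolding ln_eq using int by auto
  with pos have "log_quant_cost \<nu> A = exp (\<integral>x. ln (max_dist x A) \<partial>\<nu>)"
    by (simp add: log_quant_cost_def)
  also have "\<dots> = 2 powr (\<integral>x. log 2 (max_dist x A) \<partial>\<nu>)"
    unfolding ln_eq by (simp add: powr_def mult.commute)
  finally show "log_quant_cost \<nu> A = 2 powr (\<integral>x. log 2 (max_dist x A) \<partial>\<nu>)" .
  fix b :: real assume b: "b \<ge> 0" "(\<integral>\<^sup>+x. near_count A x \<partial>\<nu>) \<le> ennreal b"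
  have "ennreal (\<integral>x. W x \<partial>\<nu>) = (\<integral>\<^sup>+x. ennreal (W x) \<partial>\<nu>)"
    using nn_integral_eq_integral[OF W] by (simp add: W_def[abs_def])
  with b nnW have "ennreal (\<integral>x. W x \<partial>\<nu>) \<le> ennreal b" by simp
  with b(1) have Wb: "(\<integral>x. W x \<partial>\<nu>) \<le> b" by simp
  have "(\<integral>x. - log 2 (max_dist x A) \<partial>\<nu>) \<le> (\<integral>x. W x \<partial>\<nu>)"
    using int W leW by (intro integral_mono_AE) auto
  with Wb show "- b \<le> (\<integral>x. log 2 (max_dist x A) \<partial>\<nu>)" by simp
qed

text \<open>The bound for \<open>near_count\<close> is uniform over all competing sets and so passes
  to the infimum, which in particular is positive.\<close>

lemma quant_error0_ge:
  assumes p: "p > 1"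
  obtains B where "\<And>N. N \<ge> 2 \<Longrightarrow>
    0 < quant_error0 \<nu> N \<and> - log 2 (quant_error0 \<nu> N) \<le> mean_threshold_time (real N powr - p) + B"
proof -
  obtain B where B: "B \<ge> 0" "\<And>N A. N \<ge> 2 \<Longrightarrow> finite A \<Longrightarrow> A \<noteq> {} \<Longrightarrow> card A \<le> N \<Longrightarrow>
      (\<integral>\<^sup>+x. near_count A x \<partial>\<nu>) \<le> ennreal (mean_threshold_time (real N powr - p) + B)"
    using nn_integral_near_count_le[OF p] by blast
  show ?thesis
  proof
    fix N :: nat assume N: "N \<ge> 2"
    define b where "b = mean_threshold_time (real N powr - p) + B"
    have b: "b \<ge> 0" using B(1) by (simp add: b_def mean_threshold_time_def)
    have "2 powr - b \<le> quant_error0 \<nu> N"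
      unfolding quant_error0_def
    proof (rule cInf_greatest)
      \<comment> \<open>A competitor, so that the infimum is taken over a non-empty set.\<close>
      have "{0} \<in> {A :: (real ^ 'n) set. finite A \<and> 1 \<le> card A \<and> card A \<le> N}"
        using N by simp
      then show "log_quant_cost \<nu> ` {A. finite A \<and> 1 \<le> card A \<and> card A \<le> N} \<noteq> {}" by blast
      fix c assume "c \<in> log_quant_cost \<nu> ` {A. finite A \<and> 1 \<le> card A \<and> card A \<le> N}"
      then obtain A where A: "c = log_quant_cost \<nu> A" "finite A" "A \<noteq> {}" "card A \<le> N"
        by fastforce
      show "2 powr - b \<le> c"
        unfolding A(1) log_quant_cost_eq[OF A(2,3)]
        using integral_log_max_dist_ge[OF A(2,3) b] B(2)[OF N A(2-4)]
        by (simp add: b_def)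
    qed
    moreover have "0 < 2 powr - b" by simp
    ultimately have pos: "0 < quant_error0 \<nu> N" by linarith
    have "- b = log 2 (2 powr - b)" by simp
    also have "\<dots> \<le> log 2 (quant_error0 \<nu> N)"
      using \<open>2 powr - b \<le> quant_error0 \<nu> N\<close> pos by (subst log_le_cancel_iff) auto
    finally show "0 < quant_error0 \<nu> N \<and>
        - log 2 (quant_error0 \<nu> N) \<le> mean_threshold_time (real N powr - p) + B"
      using pos by (simp add: b_def)
  qed
qed

section \<open>Upper bound for the quantization error by points in the heavy cubes\<close>

lemma heavy_cubes_card_le:
  assumes "0 < t"
  shows "real (card {Q \<in> dyadic_partition k. t \<le> measure \<nu> Q}) \<le> 1 / t"
proof -
  let ?H = "{Q \<in> dyadic_partition k. t \<le> measure \<nu> Q}"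
  have "real (card ?H) * t = (\<Sum>Q\<in>?H. t)" by simp
  also have "\<dots> \<le> (\<Sum>Q\<in>?H. measure \<nu> Q)" by (intro sum_mono) auto
  also have "\<dots> = measure \<nu> (\<Union>Q\<in>?H. Q)"
    using dyadic_partition_disjoint partition_sets
    by (intro finite_measure_finite_Union[symmetric])
       (auto simp: disjoint_family_on_def disjoint_def)
  also have "\<dots> \<le> 1" by simp
  finally show ?thesis using assms by (simp add: field_simps)
qed

text \<open>The cell of level \<open>threshold_time - 1\<close> is the last heavy one around a point
  and carries a point of \<open>A\<close>, which gives the distance bound. Each level has at most
  \<open>1 / t\<close> heavy cubes, and the number of levels needed is logarithmic in
  \<open>1 / t\<close>.\<close>

lemma quant_error0_le:
  assumes t: "0 < t" "t < 1" and N: "(log 2 (C / t) / a + 2) / t \<le> real N" and pos: "0 < quant_error0 \<nu> N"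
  shows "mean_threshold_time t - 1 \<le> - log 2 (quant_error0 \<nu> N)"
proof -
  \<comment> \<open>An integer above all threshold times, so the levels below \<open>K\<close>
    contain every last heavy level.\<close>
  define K where "K = nat \<lceil>log 2 (C / t) / a + 1\<rceil>"
  have l0: "0 \<le> log 2 (C / t) / a" using t C_ge_1 a_pos by simp
  have K: "real K \<le> log 2 (C / t) / a + 2" "log 2 (C / t) / a + 1 \<le> real K"
    unfolding K_def using l0 by linarith+
  \<comment> \<open>The lower corner of the cube is a witness; the choice makes the point depend on
    the cube instead of its index.\<close>
  define z where "z k Q = (SOME z :: real ^ 'n. \<forall>x\<in>Q. infnorm (x - z) \<le> 1 / 2 ^ k)"
    for k and Q :: "(real ^ 'n) set"
  have z: "infnorm (x - z k Q) \<le> 1 / 2 ^ k" if "Q \<in> dyadic_partition k" "x \<in> Q" for k Q x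
  proof -
    have "\<exists>z. \<forall>x\<in>Q. infnorm (x - z) \<le> 1 / 2 ^ k"
      using that(1) by (auto simp: dyadic_partition_def intro: infnorm_dyadic_corner_le)
    from someI_ex[OF this] that(2) show ?thesis by (auto simp: z_def)
  qed
  define H where "H k = {Q \<in> dyadic_partition k :: (real ^ 'n) set set. t \<le> measure \<nu> Q}" for k
  define A where "A = (\<Union>k<K. z k ` H k)"
  have fin: "finite A" by (auto simp: A_def H_def)
  have near: "\<exists>y\<in>A. infnorm (x - y) \<le> 1 / 2 ^ (threshold_time \<nu> t x - 1)" if x: "regular x" for x
  proof -
    define k where "k = threshold_time \<nu> t x - 1"
    have "real (threshold_time \<nu> t x) \<le> real K"
      using threshold_time_le[OF x t] K(2) by linarith
    then have k: "k < K" "k < threshold_time \<nu> t x"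
      using threshold_time_ge_1[OF x t] by (auto simp: k_def)
    have part: "dyadic_cell k x \<in> dyadic_partition k" and mem: "x \<in> dyadic_cell k x"
      using regular_box[OF x] by (auto intro: dyadic_cell_in_partition mem_dyadic_cell)
    have "z k (dyadic_cell k x) \<in> A"
      using k part le_cell_mass_iff[OF x t, of k] by (auto simp: A_def H_def)
    with z[OF part mem] show ?thesis by (auto simp: k_def)
  qed
  have "\<exists>x. regular x"
  proof (rule ccontr)
    assume "\<nexists>x. regular x"
    with AE_regular have "AE x in \<nu>. False" by simp
    then show False by simp
  qed
  with near have ne: "A \<noteq> {}" by blast
  have "real (card A) \<le> real (\<Sum>k<K. card (z k ` H k))"
    unfolding A_def by (intro of_nat_mono card_UN_le) auto
  also have "\<dots> \<le> real (\<Sum>k<K. card (H k))"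
    by (intro of_nat_mono sum_mono card_image_le) (auto simp: H_def)
  also have "\<dots> \<le> (\<Sum>k<K. 1 / t)"
    unfolding of_nat_sum H_def by (intro sum_mono heavy_cubes_card_le t)
  also have "\<dots> = real K / t" by simp
  also have "\<dots> \<le> (log 2 (C / t) / a + 2) / t"
    using K(1) t by (intro divide_right_mono) auto
  also note N
  finally have card: "card A \<le> N" by simp
  have "quant_error0 \<nu> N \<le> log_quant_cost \<nu> A"
    unfolding quant_error0_def
  proof (rule cInf_lower)
    show "log_quant_cost \<nu> A \<in> log_quant_cost \<nu> ` {A. finite A \<and> 1 \<le> card A \<and> card A \<le> N}"
      using fin ne card by (auto simp: Suc_le_eq card_gt_0_iff)
    show "bdd_below (log_quant_cost \<nu> ` {A. finite A \<and> 1 \<le> card A \<and> card A \<le> N})"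
      by (intro bdd_belowI2[of _ 0]) (auto simp: log_quant_cost_def)
  qed
  then have "log 2 (quant_error0 \<nu> N) \<le> log 2 (log_quant_cost \<nu> A)"
    using pos by simp
  also have "\<dots> = (\<integral>x. log 2 (max_dist x A) \<partial>\<nu>)"
    by (simp add: log_quant_cost_eq[OF fin ne])
  also have "\<dots> \<le> (\<integral>x. 1 - real (threshold_time \<nu> t x) \<partial>\<nu>)"
  proof (rule integral_mono_AE)
    show "AE x in \<nu>. log 2 (max_dist x A) \<le> 1 - real (threshold_time \<nu> t x)"
      using AE_regular AE_max_dist_pos[OF fin ne]
    proof eventually_elim
      case (elim x)
      obtain y where y: "y \<in> A" "infnorm (x - y) \<le> 1 / 2 ^ (threshold_time \<nu> t x - 1)"
        using near[OF elim(1)] by auto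
      have "max_dist x A \<le> 1 / 2 ^ (threshold_time \<nu> t x - 1)"
        using max_dist_le[OF fin y(1), of x] y(2) by linarith
      also have "\<dots> = 2 powr (1 - real (threshold_time \<nu> t x))"
        using threshold_time_ge_1[OF elim(1) t]
        by (simp add: powr_diff powr_realpow power_diff)
      finally have "log 2 (max_dist x A) \<le> log 2 (2 powr (1 - real (threshold_time \<nu> t x)))"
        using elim(2) by (subst log_le_cancel_iff) auto
      then show ?case by simp
    qed
  qed (use integrable_log_max_dist[OF fin ne] integrable_threshold_time[OF t] in auto)
  also have "\<dots> = 1 - mean_threshold_time t"
    unfolding mean_threshold_time_def
    using integrable_threshold_time[OF t] by (simp add: prob_space)
  finally show ?thesis by simp
qed

text \<open>For \<open>t = N powr - q\<close> the number of points used is of order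
  \<open>N powr q * log 2 N\<close>, which is below \<open>N\<close> in the long run since
  \<open>q < 1\<close>.\<close>

lemma eventually_cover_count_le:
  assumes q: "0 < q" "q < 1"
  shows "eventually (\<lambda>N. (log 2 (C / real N powr - q) / a + 2) / real N powr - q \<le> real N) sequentially"
proof -
  \<comment> \<open>This is the left side of the claim divided by \<open>N\<close>.\<close>
  have "(\<lambda>N. (log 2 C / a + 2) * real N powr (q - 1) + q / a * (log 2 (real N) / real N powr (1 - q)))
      \<longlonglongrightarrow> (log 2 C / a + 2) * 0 + q / a * 0"
  proof (intro tendsto_intros)
    show "(\<lambda>N. real N powr (q - 1)) \<longlonglongrightarrow> 0"
      using q by (intro tendsto_neg_powr filterlim_real_sequentially) auto
    have "(\<lambda>N. ln (real N) / real N powr (1 - q)) \<longlonglongrightarrow> 0"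
      using q by (intro lim_ln_over_power) auto
    from tendsto_divide[OF this tendsto_const[of "ln 2"]]
    show "(\<lambda>N. log 2 (real N) / real N powr (1 - q)) \<longlonglongrightarrow> 0"
      by (simp add: log_def mult.commute divide_divide_eq_left)
  qed
  then have "eventually (\<lambda>N. (log 2 C / a + 2) * real N powr (q - 1) +
      q / a * (log 2 (real N) / real N powr (1 - q)) < 1) sequentially"
    by (intro order_tendstoD) auto
  with eventually_gt_at_top[of 0] show ?thesis
  proof eventually_elim
    case (elim N)
    define u where "u = real N powr q"
    have u: "u > 0" using elim(1) by (simp add: u_def)
    have e: "real N powr (q - 1) = u / real N" "real N powr (1 - q) = real N / u" "real N powr - q = 1 / u"
      using elim(1) by (simp_all add: u_def powr_diff powr_minus inverse_eq_divide)
    have "log 2 (C * u) = log 2 C + q * log 2 (real N)"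
      using elim(1) C_ge_1 by (simp add: u_def log_mult log_powr)
    then have "(log 2 (C / real N powr - q) / a + 2) / real N powr - q = (log 2 C / a + 2 + q / a * log 2 (real N)) * u"
      by (simp add: e add_divide_distrib algebra_simps)
    also have "\<dots> \<le> real N"
      using elim u by (simp add: e field_simps)
    finally show ?case .
  qed
qed

section \<open>Asymptotics of the reciprocal of the ratio defining the quantization
  dimensions\<close>

abbreviation quant_ratio :: "nat \<Rightarrow> real" where
  "quant_ratio N \<equiv> - log 2 (quant_error0 \<nu> N) / log 2 (real N)"

text \<open>Starting at \<open>N = 2\<close> keeps \<open>log 2 N\<close> positive and supplies the
  uniform bound below 1 that the limits of mean threshold times require.\<close>

lemma threshold_sequence:
  assumes r: "0 < r"
  defines "t \<equiv> \<lambda>n. real (n + 2) powr - r"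
  shows "0 < t n" "t n \<le> 2 powr - r" "t \<longlonglongrightarrow> 0" "2 powr - r < (1::real)" "t n < 1"
    and "log 2 (1 / t n) = r * log 2 (real (n + 2))"
proof -
  show "0 < t n" by (simp add: t_def)
  have "real (n + 2) powr - r \<le> 2 powr - r" using r by (intro powr_mono2') auto
  then show le: "t n \<le> 2 powr - r" by (simp add: t_def)
  show less: "2 powr - r < (1::real)" using r powr_less_mono[of "- r" 0 "2::real"] by simp
  from le less show "t n < 1" by linarith
  have "filterlim (\<lambda>n. real (n + 2)) at_top sequentially"
    by (rule filterlim_compose[OF filterlim_real_sequentially filterlim_add_const_nat_at_top])
  then show "t \<longlonglongrightarrow> 0"
    unfolding t_def using r by (intro tendsto_neg_powr) auto
  show "log 2 (1 / t n) = r * log 2 (real (n + 2))"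
    by (simp add: t_def log_divide log_powr)
qed

lemma divide_log_tendsto_0: "(\<lambda>n. b / log 2 (real (n + 2))) \<longlonglongrightarrow> 0"
proof -
  have "filterlim (\<lambda>n. real (n + 2)) at_top sequentially"
    by (rule filterlim_compose[OF filterlim_real_sequentially filterlim_add_const_nat_at_top])
  from filterlim_compose[OF ln_at_top this]
  have "(\<lambda>n. b * ln 2 / ln (real (n + 2))) \<longlonglongrightarrow> 0"
    by (rule real_tendsto_divide_at_top[OF tendsto_const])
  then show ?thesis by (simp add: log_def)
qed

text \<open>Since \<open>log 2 (1 / t) = p * log 2 N\<close>, the ratio is asymptotically at most
  \<open>p\<close> times the integral; the constant \<open>B\<close> disappears after division by
  \<open>log 2 N\<close>.\<close>

lemma eventually_quant_ratio_less:
  assumes c: "pos_integral \<nu> (\<lambda>x. 1 / lower_local_dim \<nu> x) < ereal c" "0 < c"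
  shows "eventually (\<lambda>N. quant_ratio N < c) sequentially"
proof -
  \<comment> \<open>The maximum with 0 makes \<open>b\<close> positive, as the division by
    \<open>b\<close> requires.\<close>
  have "max 0 (pos_integral \<nu> (\<lambda>x. 1 / lower_local_dim \<nu> x)) < ereal c"
    using c by (simp add: max_def)
  then obtain b where b: "max 0 (pos_integral \<nu> (\<lambda>x. 1 / lower_local_dim \<nu> x)) < ereal b" "ereal b < ereal c"
    using ereal_dense2 by blast
  then have b': "0 < b" "b < c" by auto
  \<comment> \<open>The midpoint of 1 and \<open>c / b\<close>, so \<open>p * b\<close> is the mean
    of \<open>b\<close> and \<open>c\<close>.\<close>
  define p where "p = (1 + c / b) / 2"
  have p: "1 < p" "p * b < c" using b' by (auto simp: p_def field_simps)
  obtain B where B: "\<And>N. N \<ge> 2 \<Longrightarrow>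
    0 < quant_error0 \<nu> N \<and> - log 2 (quant_error0 \<nu> N) \<le> mean_threshold_time (real N powr - p) + B"
    using quant_error0_ge[OF p(1)] by blast
  have p0: "0 < p" using p(1) by simp
  note t = threshold_sequence[OF p0]
  have "eventually (\<lambda>n. ereal (mean_threshold_time (real (n + 2) powr - p) / log 2 (1 / real (n + 2) powr - p)) < ereal b) sequentially"
    using b(1) le_pos_integral_inverse_lower[OF t(1) t(2) t(3) t(4)]
    by (intro Limsup_lessD) auto
  moreover have "eventually (\<lambda>n. B / log 2 (real (n + 2)) < c - p * b) sequentially"
    using p by (intro order_tendstoD[OF divide_log_tendsto_0]) simp
  ultimately have "eventually (\<lambda>n. quant_ratio (n + 2) < c) sequentially"
  proof eventually_elim
    case (elim n)
    define l where "l = log 2 (real (n + 2))"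
    have l: "0 < l" by (simp add: l_def)
    have "mean_threshold_time (real (n + 2) powr - p) / (p * l) < b"
      using elim(1) unfolding t(6) l_def by simp
    then have "mean_threshold_time (real (n + 2) powr - p) / l < p * b"
      using p0 l by (simp add: field_simps)
    moreover have "quant_ratio (n + 2) \<le> (mean_threshold_time (real (n + 2) powr - p) + B) / l"
      using B[of "n + 2"] l unfolding l_def by (intro divide_right_mono) auto
    ultimately show ?case
      using elim(2) unfolding l_def[symmetric] add_divide_distrib by linarith
  qed
  then show ?thesis by (rule eventually_sequentially_seg[THEN iffD1])
qed

text \<open>The dual estimate, with \<open>q\<close> the midpoint of \<open>c / b\<close> and 1. The
  loss of 1 in \<open>quant_error0_le\<close> is negligible against \<open>log 2 N\<close>.\<close>

lemma eventually_quant_ratio_greater: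
  assumes c: "ereal c < pos_integral \<nu> (\<lambda>x. 1 / upper_local_dim \<nu> x)" "0 < c"
  shows "eventually (\<lambda>N. c < quant_ratio N) sequentially"
proof -
  obtain b where b: "ereal b < pos_integral \<nu> (\<lambda>x. 1 / upper_local_dim \<nu> x)" "ereal c < ereal b"
    using c(1) ereal_dense2 by blast
  then have b': "c < b" "0 < b" using c(2) by auto
  define q where "q = (1 + c / b) / 2"
  have q: "0 < q" "q < 1" "c < q * b" using b' c(2) by (auto simp: q_def field_simps)
  note t = threshold_sequence[OF q(1)]
  \<comment> \<open>Used for the positivity of the quantization error, which
    \<open>quant_error0_le\<close> presupposes.\<close>
  obtain B where B: "\<And>N. N \<ge> 2 \<Longrightarrow>
    0 < quant_error0 \<nu> N \<and> - log 2 (quant_error0 \<nu> N) \<le> mean_threshold_time (real N powr - 2) + B"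
    using quant_error0_ge[of 2] by auto
  have "eventually (\<lambda>n. ereal b < ereal (mean_threshold_time (real (n + 2) powr - q) / log 2 (1 / real (n + 2) powr - q))) sequentially"
    using b(1) pos_integral_inverse_upper_le[OF t(1) t(2) t(3) t(4)]
    by (intro less_LiminfD) auto
  moreover have "eventually (\<lambda>n. 1 / log 2 (real (n + 2)) < q * b - c) sequentially"
    using q by (intro order_tendstoD[OF divide_log_tendsto_0]) simp
  moreover have "eventually (\<lambda>n. (log 2 (C / real (n + 2) powr - q) / a + 2) / real (n + 2) powr - q \<le> real (n + 2)) sequentially"
    using eventually_cover_count_le[OF q(1,2)] by (rule eventually_sequentially_seg[THEN iffD2])
  ultimately have "eventually (\<lambda>n. c < quant_ratio (n + 2)) sequentially"
  proof eventually_elim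
    case (elim n)
    define l where "l = log 2 (real (n + 2))"
    have l: "0 < l" by (simp add: l_def)
    have "b < mean_threshold_time (real (n + 2) powr - q) / (q * l)"
      using elim(1) unfolding t(6) l_def by simp
    then have "q * b < mean_threshold_time (real (n + 2) powr - q) / l"
      using q l by (simp add: field_simps)
    moreover have "(mean_threshold_time (real (n + 2) powr - q) - 1) / l \<le> quant_ratio (n + 2)"
      unfolding l_def[symmetric]
      using quant_error0_le[OF t(1) t(5) elim(3)] B[of "n + 2"] l
      by (intro divide_right_mono) auto
    ultimately show ?case
      using elim(2) unfolding l_def[symmetric] diff_divide_distrib by linarith
  qed
  then show ?thesis by (rule eventually_sequentially_seg[THEN iffD1])
qed

section \<open>Finiteness and positivity, and the bounds for the quantization dimensions\<close>

lemma finite_pos_integrals: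
  shows "finite_pos (pos_integral \<nu> (lower_local_dim \<nu>))"
    and "finite_pos (pos_integral \<nu> (upper_local_dim \<nu>))"
    and "AE x in \<nu>. finite_pos (1 / lower_local_dim \<nu> x) \<and> finite_pos (1 / upper_local_dim \<nu> x)"
    and "finite_pos (pos_integral \<nu> (\<lambda>x. 1 / lower_local_dim \<nu> x))"
    and "finite_pos (pos_integral \<nu> (\<lambda>x. 1 / upper_local_dim \<nu> x))"
    and "lower_local_dim \<nu> \<in> borel_measurable \<nu>"
    and "upper_local_dim \<nu> \<in> borel_measurable \<nu>"
proof -
  obtain W where W: "integrable \<nu> W" "AE x in \<nu>. \<forall>k. local_exponent \<nu> k x \<le> W x"
    by (rule local_exponent_majorant)
  have meas: "lower_local_dim \<nu> \<in> borel_measurable \<nu>" and meas' [measurable]: "upper_local_dim \<nu> \<in> borel_measurable \<nu>"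
    unfolding lower_local_dim_def[abs_def] upper_local_dim_def[abs_def] by measurable
  then show "lower_local_dim \<nu> \<in> borel_measurable \<nu>" "upper_local_dim \<nu> \<in> borel_measurable \<nu>" by auto
  have W0: "AE x in \<nu>. 0 \<le> W x"
    using W(2) AE_regular by eventually_elim (meson local_exponent_nonneg order_trans)
  have ge: "AE x in \<nu>. ereal a \<le> lower_local_dim \<nu> x"
    using AE_regular by eventually_elim (rule a_le_lower_local_dim)
  have le: "AE x in \<nu>. upper_local_dim \<nu> x \<le> ereal (W x)"
    using W(2)
  proof eventually_elim
    case (elim x)
    then show ?case unfolding upper_local_dim_def by (intro Limsup_bounded) auto
  qed
  have const: "pos_integral \<nu> (\<lambda>_. ereal c) = ereal c" if "c \<ge> 0" for c
    using pos_integral_ereal[of \<nu> "\<lambda>_. c"] that by (simp add: prob_space)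
  have 1: "ereal a \<le> pos_integral \<nu> (lower_local_dim \<nu>)"
    using pos_integral_mono_AE[OF ge] a_pos by (simp add: const)
  have 2: "pos_integral \<nu> (lower_local_dim \<nu>) \<le> pos_integral \<nu> (upper_local_dim \<nu>)"
    by (intro pos_integral_mono_AE AE_I2 lower_le_upper_local_dim)
  have 3: "pos_integral \<nu> (upper_local_dim \<nu>) < \<infinity>"
    using pos_integral_mono_AE[OF le] by (auto simp: pos_integral_ereal[OF W(1) W0])
  have a0: "0 < ereal a" using a_pos by simp
  show "finite_pos (pos_integral \<nu> (lower_local_dim \<nu>))" "finite_pos (pos_integral \<nu> (upper_local_dim \<nu>))"
    unfolding finite_pos_def
    using less_le_trans[OF a0 1] less_le_trans[OF a0 order_trans[OF 1 2]] le_less_trans[OF 2 3] 3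
    by auto
  show ae: "AE x in \<nu>. finite_pos (1 / lower_local_dim \<nu> x) \<and> finite_pos (1 / upper_local_dim \<nu> x)"
    using ge le
  proof eventually_elim
    case (elim x)
    have "finite_pos (1 / y)" if "ereal a \<le> y" "y \<le> ereal (W x)" for y
      using that a_pos by (cases y) (auto simp: finite_pos_def divide_ereal_def)
    with elim lower_le_upper_local_dim[of x] show ?case by (auto intro: order_trans)
  qed
  have "AE x in \<nu>. 1 / lower_local_dim \<nu> x \<le> ereal (1 / a)"
    using ge
  proof eventually_elim
    case (elim x)
    then show ?case
      using a_pos by (cases "lower_local_dim \<nu> x") (auto simp: divide_ereal_def inverse_eq_divide frac_le)
  qed
  from pos_integral_mono_AE[OF this] have 4: "pos_integral \<nu> (\<lambda>x. 1 / lower_local_dim \<nu> x) < \<infinity>"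
    using a_pos by (auto simp: const)
  have 5: "pos_integral \<nu> (\<lambda>x. 1 / upper_local_dim \<nu> x) \<le> pos_integral \<nu> (\<lambda>x. 1 / lower_local_dim \<nu> x)"
  proof (intro pos_integral_mono_AE)
    show "AE x in \<nu>. 1 / upper_local_dim \<nu> x \<le> 1 / lower_local_dim \<nu> x"
      using ge
    proof eventually_elim
      case (elim x)
      then have "0 \<le> lower_local_dim \<nu> x" using a0 by (meson less_imp_le order_trans)
      then show ?case
        by (simp add: divide_ereal_def ereal_inverse_antimono lower_le_upper_local_dim)
    qed
  qed
  \<comment> \<open>The upper local dimension is bounded only by the integrable \<open>W\<close>, so
    no constant lower bound for its reciprocal is at hand. Instead, a vanishing integral would force
    the integrand to be 0 almost everywhere, against its positivity.\<close>
  have 6: "0 < pos_integral \<nu> (\<lambda>x. 1 / upper_local_dim \<nu> x)"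
  proof (rule ccontr)
    assume "\<not> 0 < pos_integral \<nu> (\<lambda>x. 1 / upper_local_dim \<nu> x)"
    then have "(\<integral>\<^sup>+x. e2ennreal (1 / upper_local_dim \<nu> x) \<partial>\<nu>) = 0"
      unfolding pos_integral_def by (metis enn2ereal_inject enn2ereal_nonneg order_le_less zero_ennreal.rep_eq)
    then have "AE x in \<nu>. e2ennreal (1 / upper_local_dim \<nu> x) = 0"
      by (subst (asm) nn_integral_0_iff_AE) measurable
    with ae have "AE x in \<nu>. False"
    proof eventually_elim
      case (elim x)
      then show ?case
        by (metis enn2ereal_e2ennreal finite_pos_def less_imp_le less_irrefl zero_ennreal.rep_eq)
    qed
    then show False by simp
  qed
  show "finite_pos (pos_integral \<nu> (\<lambda>x. 1 / lower_local_dim \<nu> x))"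
       "finite_pos (pos_integral \<nu> (\<lambda>x. 1 / upper_local_dim \<nu> x))"
    unfolding finite_pos_def using 4 5 6 by (auto intro: less_le_trans le_less_trans)
qed

lemma
  shows inverse_lower_le_lower_quant_dim0:
      "1 / pos_integral \<nu> (\<lambda>x. 1 / lower_local_dim \<nu> x) \<le> lower_quant_dim0 \<nu>"
    and upper_quant_dim0_le_inverse_upper:
      "upper_quant_dim0 \<nu> \<le> 1 / pos_integral \<nu> (\<lambda>x. 1 / upper_local_dim \<nu> x)"
proof -
  define I J where "I = pos_integral \<nu> (\<lambda>x. 1 / lower_local_dim \<nu> x)"
    and "J = pos_integral \<nu> (\<lambda>x. 1 / upper_local_dim \<nu> x)"
  have I: "0 < I" "I < \<infinity>" and J: "0 < J" "J < \<infinity>"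
    using finite_pos_integrals(4,5) by (auto simp: finite_pos_def I_def J_def)
  \<comment> \<open>A positive number below \<open>J\<close> makes \<open>quant_ratio\<close>
    eventually positive.\<close>
  obtain c where c: "0 < ereal c" "ereal c < J" using ereal_dense2[OF J(1)] by auto
  then have pos: "eventually (\<lambda>N. 0 < quant_ratio N) sequentially"
    using eventually_quant_ratio_greater[of c] by (auto simp: J_def elim!: eventually_mono)
  have nonneg: "eventually (\<lambda>N. 0 \<le> ereal (quant_ratio N)) sequentially"
    using pos by eventually_elim simp
  \<comment> \<open>Positivity is essential here: real division by 0 gives 0, whereas the
    \<open>ereal\<close> inverse of 0 is infinite.\<close>
  have inv: "eventually (\<lambda>N. ereal (log 2 (real N) / - log 2 (quant_error0 \<nu> N)) =
      inverse (ereal (quant_ratio N))) sequentially"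
    using pos by eventually_elim (auto simp: inverse_eq_divide)
  have lsup: "limsup (\<lambda>N. ereal (quant_ratio N)) \<le> I"
    unfolding Limsup_le_iff
  proof (intro allI impI)
    fix y assume "y > I"
    then obtain c where c: "I < ereal c" "ereal c < y" using ereal_dense2 by blast
    with I(1) have "0 < c" by (metis less_trans ereal_less(2))
    from eventually_quant_ratio_less[OF c(1)[unfolded I_def] this]
    show "eventually (\<lambda>N. ereal (quant_ratio N) < y) sequentially"
    proof eventually_elim
      case (elim N)
      then have "ereal (quant_ratio N) < ereal c" by simp
      then show ?case using c(2) by (rule less_trans)
    qed
  qed
  have linf: "J \<le> liminf (\<lambda>N. ereal (quant_ratio N))"
    unfolding le_Liminf_iff
  proof (intro allI impI)
    fix y assume "y < J"
    then obtain c where c: "max 0 y < ereal c" "ereal c < J"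
      using J(1) ereal_dense2[of "max 0 y" J] by auto
    then have "0 < c" by simp
    from eventually_quant_ratio_greater[OF c(2)[unfolded J_def] this]
    show "eventually (\<lambda>N. y < ereal (quant_ratio N)) sequentially"
    proof eventually_elim
      case (elim N)
      have "y < ereal c" using c(1) by simp
      also have "\<dots> < ereal (quant_ratio N)" using elim by simp
      finally show ?case .
    qed
  qed
  have "lower_quant_dim0 \<nu> = inverse (limsup (\<lambda>N. ereal (quant_ratio N)))"
    unfolding lower_quant_dim0_def Liminf_eq[OF inv]
    by (rule Liminf_inverse_ereal[OF sequentially_bot nonneg])
  moreover have "0 \<le> limsup (\<lambda>N. ereal (quant_ratio N))"
    using nonneg by (intro le_Limsup) auto
  ultimately show "1 / I \<le> lower_quant_dim0 \<nu>"
    using lsup by (simp add: divide_ereal_def ereal_inverse_antimono)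
  have "upper_quant_dim0 \<nu> = inverse (liminf (\<lambda>N. ereal (quant_ratio N)))"
    unfolding upper_quant_dim0_def Limsup_eq[OF inv]
    by (rule Limsup_inverse_ereal[OF sequentially_bot nonneg])
  then show "upper_quant_dim0 \<nu> \<le> 1 / J"
    using linf J(1) by (simp add: divide_ereal_def ereal_inverse_antimono)
qed

end
theorem proposition3p3:
  fixes \<nu> :: "(real ^ 'n::finite) measure" and a C :: real
  assumes "prob_space \<nu>" and "sets \<nu> = sets borel"
    and "msupport \<nu> \<subseteq> interior (cbox 0 1)"
    and "a > 0" and "C \<ge> 1"
    and "\<And>k Q. Q \<in> dyadic_partition k \<Longrightarrow> measure \<nu> Q \<le> C * 2 powr (- a * real k)"
  shows
    "lower_local_dim \<nu> \<in> borel_measurable \<nu> \<and> upper_local_dim \<nu> \<in> borel_measurable \<nu> \<and>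
     (pos_integral \<nu> (lower_local_dim \<nu>) \<le> lower_entropy \<nu> \<and>
      lower_entropy \<nu> \<le> upper_entropy \<nu> \<and>
      upper_entropy \<nu> \<le> pos_integral \<nu> (upper_local_dim \<nu>)) \<and>
     (1 / pos_integral \<nu> (\<lambda>x. 1 / lower_local_dim \<nu> x) \<le> lower_quant_dim0 \<nu> \<and>
      lower_quant_dim0 \<nu> \<le> upper_quant_dim0 \<nu> \<and>
      upper_quant_dim0 \<nu> \<le> 1 / pos_integral \<nu> (\<lambda>x. 1 / upper_local_dim \<nu> x)) \<and>
     (finite_pos (pos_integral \<nu> (lower_local_dim \<nu>)) \<and>
      finite_pos (pos_integral \<nu> (upper_local_dim \<nu>)) \<and>
      (AE x in \<nu>. finite_pos (1 / lower_local_dim \<nu> x) \<and> finite_pos (1 / upper_local_dim \<nu> x)) \<and>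
      finite_pos (pos_integral \<nu> (\<lambda>x. 1 / lower_local_dim \<nu> x)) \<and>
      finite_pos (pos_integral \<nu> (\<lambda>x. 1 / upper_local_dim \<nu> x)) \<and>
      finite_pos (1 / pos_integral \<nu> (\<lambda>x. 1 / lower_local_dim \<nu> x)) \<and>
      finite_pos (1 / pos_integral \<nu> (\<lambda>x. 1 / upper_local_dim \<nu> x))) \<and>
     (pos_integral \<nu> (lower_local_dim \<nu>) \<le> Liminf (at_right 0) (\<lambda>t. ereal (threshold_mean \<nu> t)) \<and>
      Liminf (at_right 0) (\<lambda>t. ereal (threshold_mean \<nu> t))
        \<le> Limsup (at_right 0) (\<lambda>t. ereal (threshold_mean \<nu> t)) \<and>
      Limsup (at_right 0) (\<lambda>t. ereal (threshold_mean \<nu> t)) \<le> pos_integral \<nu> (upper_local_dim \<nu>))"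
proof -
  interpret decaying_cube_measure \<nu> a C
    using assms by (simp add: decaying_cube_measure_def decaying_cube_measure_axioms_def)
  have finite_pos_inverse: "finite_pos (1 / r)" if "finite_pos r" for r
    using that by (cases r) (auto simp: finite_pos_def divide_ereal_def)
  have "lower_entropy \<nu> \<le> upper_entropy \<nu>"
    unfolding lower_entropy_def upper_entropy_def by (intro Liminf_le_Limsup) simp
  moreover have "lower_quant_dim0 \<nu> \<le> upper_quant_dim0 \<nu>"
    unfolding lower_quant_dim0_def upper_quant_dim0_def by (intro Liminf_le_Limsup) simp
  moreover have "Liminf (at_right 0) (\<lambda>t. ereal (threshold_mean \<nu> t))
      \<le> Limsup (at_right 0) (\<lambda>t. ereal (threshold_mean \<nu> t))"
    by (intro Liminf_le_Limsup) simp
  ultimately show ?thesis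
    by (intro conjI finite_pos_integrals finite_pos_inverse[OF finite_pos_integrals(4)]
        finite_pos_inverse[OF finite_pos_integrals(5)] pos_integral_lower_le_lower_entropy
        upper_entropy_le_pos_integral_upper inverse_lower_le_lower_quant_dim0
        upper_quant_dim0_le_inverse_upper pos_integral_lower_le_Liminf_threshold_mean
        Limsup_threshold_mean_le_pos_integral_upper)
qed

end
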